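(* Let $\rho\in\Sigma$ and, for $\varepsilon\in I=\,]0,1]$, let $\rho_\varepsilon(x)=\frac1\varepsilon\rho\left(\frac{x}{\varepsilon}\right)$. Then the map $$i_{ap}:\mathcal{B}_{ap}'\longrightarrow\mathcal{G}_{ap},\qquad u\longmapsto (u*\rho_\varepsilon)_{\varepsilon\in I}+\mathcal{N}_{ap},$$ is a linear embedding (that is, it is well defined, linear and injective) which commutes with derivatives, i.e. $i_{ap}(u^{(j)})=(i_{ap}(u))^{(j)}$ for all $u\in\mathcal{B}_{ap}'$ and $j\in\mathbb{Z}_+$.
   Context: All functions and distributions are complex valued on $\mathbb{R}$; $I=\,]0,1]$; $\mathbb{Z}_+=\{0,1,2,\dots\}$; $\mathcal{D}$ is the space of test functions and $\mathcal{S}$ the Schwartz space. $\mathcal{C}_{ap}$ is the space of (Bohr/Bochner) almost periodic functions: continuous $f:\mathbb{R}\to\mathbb{C}$ such that every real sequence $(h_n)$ has a subsequence $(h_{n_k})$ for which $f(\cdot+h_{n_k})$ converges uniformly on $\mathbb{R}$. For $p\in[1,\infty]$, $\mathcal{D}_{L^p}=\{\varphi\in\mathcal{C}^\infty:\varphi^{(j)}\in L^p\ \forall j\in\mathbb{Z}_+\}$ with norms $|\varphi|_{k,p}=\sum_{j\le k}\|\varphi^{(j)}\|_{L^p}$, $k\in\mathbb{Z}_+$. The space of bounded distributions $\mathcal{D}'_{L^\infty}$ is the topological dual of $\mathcal{D}_{L^1}$. $\mathcal{B}_{ap}'$ is the space of almost periodic distributions, i.e. those $T\in\mathcal{D}'_{L^\infty}$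 satisfying any one of the following conditions, which are known to be equivalent: (i) the set of translates $\{\tau_hT:h\in\mathbb{R}\}$ is relatively compact in $\mathcal{D}'_{L^\infty}$; (ii) $T*\varphi\in\mathcal{C}_{ap}$ for all $\varphi\in\mathcal{D}$; (iii) $T=\sum_{j\le k}f_j^{(j)}$ for some $k$ and $f_0,\dots,f_k\in\mathcal{C}_{ap}$. For $T\in\mathcal{D}'_{L^\infty}$ and $\psi\in\mathcal{S}$, $(T*\psi)(x)=\langle T,\psi(x-\cdot)\rangle$. $\mathcal{B}_{ap}=\{\varphi\in\mathcal{D}_{L^\infty}:\varphi^{(j)}\in\mathcal{C}_{ap}\ \forall j\in\mathbb{Z}_+\}$. $\mathcal{M}_{ap}$ is the set of nets $(u_\varepsilon)_\varepsilon\in(\mathcal{B}_{ap})^I$ such that $\forall k\in\mathbb{Z}_+\ \exists m\in\mathbb{Z}_+$, $|u_\varepsilon|_{k,\infty}=O(\varepsilon^{-m})$ as $\varepsilon\to0$. $\mathcal{N}_{ap}$ is the set of nets $(u_\varepsilon)_\varepsilon\in(\mathcal{B}_{ap})^I$ such that $\forall k\in\mathbb{Z}_+\ \forall m\in\mathbb{Z}_+$, $|u_\varepsilon|_{k,\infty}=O(\varepsilon^{m})$ as $\varepsilon\to0$. The algebra of almost periodic generalized functions is the quotient $\mathcal{G}_{ap}=\mathcal{M}_{ap}/\mathcal{N}_{ap}$; operations, including differentiation, are defined componentwise on representatives. $\Sigma$ is the set of $\rho\in\mathcal{S}$ with $\int_{\mathbb{R}}\rho(x)\,dx=1$ and $\int_{\mathbb{R}}x^k\rho(x)\,dx=0$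 for all $k=1,2,\dots$. *)

theory Defs
  imports "HOL-Analysis.Analysis" "HOL-Probability.Essential_Supremum" "HOL-Library.Landau_Symbols"
begin

definition nderiv :: "nat \<Rightarrow> (real \<Rightarrow> complex) \<Rightarrow> real \<Rightarrow> complex" where
  "nderiv j f = ((\<lambda>g x. vector_derivative g (at x)) ^^ j) f"

definition smooth :: "(real \<Rightarrow> complex) \<Rightarrow> bool" where
  "smooth f \<longleftrightarrow> (\<forall>j x. nderiv j f differentiable (at x))"

definition test_functions :: "(real \<Rightarrow> complex) set" where
  "test_functions = {f. smooth f \<and> compact (closure {x. f x \<noteq> 0})}"

definition schwartz_space :: "(real \<Rightarrow> complex) set" where
  "schwartz_space = {f. smooth f \<and> (\<forall>m n. bounded (range (\<lambda>x. x ^ m *\<^sub>R nderiv n f x)))}"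


text \<open>The exponent of \<open>Lp_space\<close> and \<open>Lp_norm\<close> is meant to range over \<open>1 \<le> p \<le> \<infinity>\<close>.\<close>

definition Lp_space :: "ereal \<Rightarrow> (real \<Rightarrow> complex) set" where
  "Lp_space p = {f \<in> borel_measurable lborel.
     if p = \<infinity> then esssup lborel (\<lambda>x. ereal (norm (f x))) < \<infinity>
     else integrable lborel (\<lambda>x. norm (f x) powr real_of_ereal p)}"

definition Lp_norm :: "ereal \<Rightarrow> (real \<Rightarrow> complex) \<Rightarrow> real" where
  "Lp_norm p f =
     (if p = \<infinity> then real_of_ereal (esssup lborel (\<lambda>x. ereal (norm (f x))))
      else (LINT x|lborel. norm (f x) powr real_of_ereal p) powr (1 / real_of_ereal p))"

definition DLp :: "ereal \<Rightarrow> (real \<Rightarrow> complex) set" where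
  "DLp p = {\<phi>. smooth \<phi> \<and> (\<forall>j. nderiv j \<phi> \<in> Lp_space p)}"

definition DLp_norm :: "nat \<Rightarrow> ereal \<Rightarrow> (real \<Rightarrow> complex) \<Rightarrow> real" where
  "DLp_norm k p \<phi> = (\<Sum>j\<le>k. Lp_norm p (nderiv j \<phi>))"


text \<open>The topological dual of \<open>DLp 1\<close>. Since the norms \<open>DLp_norm k 1\<close> increase with \<open>k\<close>, their
  balls around \<open>\<phi>\<close> form a neighbourhood base, so the last clause is continuity at every \<open>\<phi>\<close>.
  Functionals take the value \<open>undefined\<close> outside \<open>DLp 1\<close>, so that \<open>=\<close> is equality of
  distributions.\<close>

definition bounded_distributions :: "((real \<Rightarrow> complex) \<Rightarrow> complex) set" where
  "bounded_distributions = {T \<in> extensional (DLp 1).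
     (\<forall>\<phi>\<in>DLp 1. \<forall>\<psi>\<in>DLp 1. T (\<lambda>x. \<phi> x + \<psi> x) = T \<phi> + T \<psi>) \<and>
     (\<forall>c. \<forall>\<phi>\<in>DLp 1. T (\<lambda>x. c * \<phi> x) = c * T \<phi>) \<and>
     (\<forall>\<phi>\<in>DLp 1. \<forall>e>0. \<exists>k. \<exists>d>0. \<forall>\<psi>\<in>DLp 1.
        DLp_norm k 1 (\<lambda>x. \<psi> x - \<phi> x) < d \<longrightarrow> norm (T \<psi> - T \<phi>) < e)}"

definition dist_add ::
  "((real \<Rightarrow> complex) \<Rightarrow> complex) \<Rightarrow> ((real \<Rightarrow> complex) \<Rightarrow> complex) \<Rightarrow> (real \<Rightarrow> complex) \<Rightarrow> complex" where
  "dist_add T S = (\<lambda>\<phi>\<in>DLp 1. T \<phi> + S \<phi>)"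

definition dist_scale ::
  "complex \<Rightarrow> ((real \<Rightarrow> complex) \<Rightarrow> complex) \<Rightarrow> (real \<Rightarrow> complex) \<Rightarrow> complex" where
  "dist_scale c T = (\<lambda>\<phi>\<in>DLp 1. c * T \<phi>)"

definition dist_deriv ::
  "nat \<Rightarrow> ((real \<Rightarrow> complex) \<Rightarrow> complex) \<Rightarrow> (real \<Rightarrow> complex) \<Rightarrow> complex" where
  "dist_deriv j T = (\<lambda>\<phi>\<in>DLp 1. (- 1) ^ j * T (nderiv j \<phi>))"

definition dist_conv ::
  "((real \<Rightarrow> complex) \<Rightarrow> complex) \<Rightarrow> (real \<Rightarrow> complex) \<Rightarrow> real \<Rightarrow> complex" where
  "dist_conv T \<psi> = (\<lambda>x. T (\<lambda>y. \<psi> (x - y)))"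


definition C_ap :: "(real \<Rightarrow> complex) set" where
  "C_ap = {f. continuous_on UNIV f \<and>
     (\<forall>h::nat \<Rightarrow> real. \<exists>r::nat \<Rightarrow> nat. strict_mono r \<and>
        (\<exists>g. uniform_limit UNIV (\<lambda>k x. f (x + h (r k))) g sequentially))}"

definition B_ap :: "(real \<Rightarrow> complex) set" where
  "B_ap = {\<phi> \<in> DLp \<infinity>. \<forall>j. nderiv j \<phi> \<in> C_ap}"

definition ap_distributions :: "((real \<Rightarrow> complex) \<Rightarrow> complex) set" where
  "ap_distributions =
     {T \<in> bounded_distributions. \<forall>\<phi>\<in>test_functions. dist_conv T \<phi> \<in> C_ap}"


text \<open>Nets indexed by the interval \<open>]0,1]\<close>, undefined elsewhere.\<close>

definition M_ap :: "(real \<Rightarrow> real \<Rightarrow> complex) set" where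
  "M_ap = {u \<in> {0<..1} \<rightarrow>\<^sub>E B_ap. \<forall>k. \<exists>m::nat.
     (\<lambda>\<epsilon>. DLp_norm k \<infinity> (u \<epsilon>)) \<in> O[at_right 0](\<lambda>\<epsilon>. \<epsilon> powr (- real m))}"

definition N_ap :: "(real \<Rightarrow> real \<Rightarrow> complex) set" where
  "N_ap = {u \<in> {0<..1} \<rightarrow>\<^sub>E B_ap. \<forall>k. \<forall>m::nat.
     (\<lambda>\<epsilon>. DLp_norm k \<infinity> (u \<epsilon>)) \<in> O[at_right 0](\<lambda>\<epsilon>. \<epsilon> ^ m)}"

definition net_add ::
  "(real \<Rightarrow> real \<Rightarrow> complex) \<Rightarrow> (real \<Rightarrow> real \<Rightarrow> complex) \<Rightarrow> real \<Rightarrow> real \<Rightarrow> complex" where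
  "net_add u v = (\<lambda>\<epsilon>\<in>{0<..1}. \<lambda>x. u \<epsilon> x + v \<epsilon> x)"

definition net_scale ::
  "complex \<Rightarrow> (real \<Rightarrow> real \<Rightarrow> complex) \<Rightarrow> real \<Rightarrow> real \<Rightarrow> complex" where
  "net_scale c u = (\<lambda>\<epsilon>\<in>{0<..1}. \<lambda>x. c * u \<epsilon> x)"

definition net_deriv ::
  "nat \<Rightarrow> (real \<Rightarrow> real \<Rightarrow> complex) \<Rightarrow> real \<Rightarrow> real \<Rightarrow> complex" where
  "net_deriv j u = (\<lambda>\<epsilon>\<in>{0<..1}. nderiv j (u \<epsilon>))"


text \<open>The quotient of \<open>M_ap\<close> by \<open>N_ap\<close> as a set of cosets. An operation on cosets is the union of
  the results over all representatives; this is a single coset exactly when the result does not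
  depend on the representatives.\<close>

definition net_class :: "(real \<Rightarrow> real \<Rightarrow> complex) \<Rightarrow> (real \<Rightarrow> real \<Rightarrow> complex) set" where
  "net_class u = net_add u ` N_ap"

definition G_ap :: "(real \<Rightarrow> real \<Rightarrow> complex) set set" where
  "G_ap = net_class ` M_ap"

definition G_add ::
  "(real \<Rightarrow> real \<Rightarrow> complex) set \<Rightarrow> (real \<Rightarrow> real \<Rightarrow> complex) set \<Rightarrow> (real \<Rightarrow> real \<Rightarrow> complex) set" where
  "G_add A B = (\<Union>u\<in>A. \<Union>v\<in>B. net_class (net_add u v))"

definition G_scale ::
  "complex \<Rightarrow> (real \<Rightarrow> real \<Rightarrow> complex) set \<Rightarrow> (real \<Rightarrow> real \<Rightarrow> complex) set" where
  "G_scale c A = (\<Union>u\<in>A. net_class (net_scale c u))"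

definition G_deriv ::
  "nat \<Rightarrow> (real \<Rightarrow> real \<Rightarrow> complex) set \<Rightarrow> (real \<Rightarrow> real \<Rightarrow> complex) set" where
  "G_deriv j A = (\<Union>u\<in>A. net_class (net_deriv j u))"


definition mollifiers :: "(real \<Rightarrow> complex) set" where
  "mollifiers = {\<rho> \<in> schwartz_space. (LINT x|lborel. \<rho> x) = 1 \<and>
     (\<forall>k\<ge>1::nat. (LINT x|lborel. of_real (x ^ k) * \<rho> x) = 0)}"

definition mollify_scale :: "(real \<Rightarrow> complex) \<Rightarrow> real \<Rightarrow> real \<Rightarrow> complex" where
  "mollify_scale \<rho> \<epsilon> = (\<lambda>x. of_real (1 / \<epsilon>) * \<rho> (x / \<epsilon>))"

definition mollify_net ::
  "(real \<Rightarrow> complex) \<Rightarrow> ((real \<Rightarrow> complex) \<Rightarrow> complex) \<Rightarrow> real \<Rightarrow> real \<Rightarrow> complex" where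
  "mollify_net \<rho> u = (\<lambda>\<epsilon>\<in>{0<..1}. dist_conv u (mollify_scale \<rho> \<epsilon>))"

definition i_ap ::
  "(real \<Rightarrow> complex) \<Rightarrow> ((real \<Rightarrow> complex) \<Rightarrow> complex) \<Rightarrow> (real \<Rightarrow> real \<Rightarrow> complex) set" where
  "i_ap \<rho> = (\<lambda>u\<in>ap_distributions. net_class (mollify_net \<rho> u))"

end

theory Submission
  imports Defs "HOL-Probability.Sinc_Integral" "HOL-Library.Diagonal_Subsequence"
    "HOL-Computational_Algebra.Polynomial"
begin

text \<open>
  A bounded distribution \<open>u\<close> satisfies \<open>\<bar>u \<phi>\<bar> \<le> C * DLp_norm k 1 \<phi>\<close> for some \<open>k\<close> and \<open>C\<close>. Hence, for rapidly
  decreasing \<open>\<psi>\<close>, the function \<open>u * \<psi>\<close> is smooth with derivatives \<open>u * \<psi>\<^sup>(\<^sup>j\<^sup>)\<close>, the derivatives of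
  \<open>u * \<rho>\<^sub>\<epsilon>\<close> grow at most like a power of \<open>1 / \<epsilon>\<close>, and, test functions being dense in \<open>DLp 1\<close>,
  \<open>u * \<psi>\<close> is a uniform limit of almost periodic functions. For injectivity let \<open>w\<close> be the
  difference of two distributions with the same image, so that \<open>w * \<rho>\<^sub>\<epsilon> = O(\<epsilon>)\<close> uniformly. A test
  function \<open>\<phi>\<close> is within \<open>O(\<epsilon>)\<close> of \<open>\<integral> \<phi>(x) \<rho>\<^sub>\<epsilon>(x - y) dx\<close> in each norm of \<open>DLp 1\<close>, and the Riemann sums
  of this integral converge in \<open>DLp 1\<close>. On such a sum \<open>w\<close> takes the value
  \<open>\<Sum>\<^sub>i c\<^sub>i (w * \<rho>\<^sub>\<epsilon>)(x\<^sub>i)\<close> with \<open>\<Sum>\<^sub>i \<bar>c\<^sub>i\<bar>\<close> bounded, so \<open>w \<phi> = O(\<epsilon>)\<close>, that is, \<open>w \<phi> = 0\<close>.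
\<close>

section \<open>Smooth functions\<close>

text \<open>A bounded distribution is only known to be linear and bounded by one norm of
  \<open>DLp 1\<close>, so it cannot simply be moved under an integral. Hence the Riemann sums,
  which have to converge in these integral norms and not merely pointwise. Pointwise estimates
  become integral estimates through one weight, \<open>1 / (1 + y\<^sup>2)\<close>: its translates
  are comparable up to a factor polynomial in the shift, and that factor is absorbed by the decay of
  the other function in the product. The kernel \<open>\<rho>\<^sub>\<epsilon>(x - y)\<close> is
  reflected because, as a function of \<open>y\<close>, it is exactly the argument on which
  \<open>w\<close> takes the value \<open>(w * \<rho>\<^sub>\<epsilon>)(x)\<close>. The number of
  nodes of a Riemann sum depends on \<open>\<epsilon>\<close> without control; what saves the
  argument is that the sum of the \<open>\<bar>c\<^sub>i\<bar>\<close> is at most the length of an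
  interval containing the support of \<open>\<phi>\<close> times a bound of
  \<open>\<bar>\<phi>\<bar>\<close>, whatever the kernel. The rate \<open>O(\<epsilon>)\<close> in
  the approximation of \<open>\<phi>\<close> comes from the unit integral of \<open>\<rho>\<close>
  and the mean value inequality.\<close>

lemma nderiv_0 [simp]: "nderiv 0 f = f"
  by (simp add: nderiv_def)

lemma nderiv_Suc: "nderiv (Suc j) f = (\<lambda>x. vector_derivative (nderiv j f) (at x))"
  by (simp add: nderiv_def)

lemma nderiv_nderiv: "nderiv i (nderiv j f) = nderiv (i + j) f"
  by (simp add: nderiv_def funpow_add)

lemma smooth_has_vector_derivative:
  assumes "smooth f"
  shows "(nderiv j f has_vector_derivative nderiv (Suc j) f x) (at x)"
  using assms by (auto simp: smooth_def nderiv_Suc vector_derivative_works[symmetric])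

lemma smooth_continuous_on: "smooth f \<Longrightarrow> continuous_on A (nderiv j f)"
  by (meson smooth_def continuous_at_imp_continuous_on differentiable_imp_continuous_within)

lemma smooth_nderiv: "smooth f \<Longrightarrow> smooth (nderiv j f)"
  by (simp add: smooth_def nderiv_nderiv)

text \<open>\<open>vector_derivative\<close> is a choice operator, so derivatives of all orders are
  computed by naming the whole sequence \<open>F\<close> and checking one differentiation step. The
  same check yields smoothness in \<open>smooth_sequence\<close>.\<close>

lemma nderiv_sequence:
  assumes "F 0 = f" and "\<And>j x. (F j has_vector_derivative F (Suc j) x) (at x)"
  shows "nderiv j f = F j"
proof (induction j)
  case (Suc j)
  then show ?case
    using assms(2)[of j] by (auto simp: nderiv_Suc vector_derivative_at)
qed (simp add: assms)

lemma smooth_sequence: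
  assumes "F 0 = f" and "\<And>j x. (F j has_vector_derivative F (Suc j) x) (at x)"
  shows "smooth f"
  unfolding smooth_def nderiv_sequence[OF assms]
  by (meson assms(2) differentiableI_vector)

lemma
  assumes "smooth f" "smooth g"
  shows nderiv_add: "nderiv j (\<lambda>x. f x + g x) = (\<lambda>x. nderiv j f x + nderiv j g x)"
    and smooth_add: "smooth (\<lambda>x. f x + g x)"
proof -
  have *: "((\<lambda>x. nderiv j f x + nderiv j g x) has_vector_derivative
      nderiv (Suc j) f x + nderiv (Suc j) g x) (at x)" for j x
    by (intro has_vector_derivative_add smooth_has_vector_derivative assms)
  show "nderiv j (\<lambda>x. f x + g x) = (\<lambda>x. nderiv j f x + nderiv j g x)"
    by (rule nderiv_sequence) (auto intro: *)
  show "smooth (\<lambda>x. f x + g x)"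
    by (rule smooth_sequence[where F="\<lambda>j x. nderiv j f x + nderiv j g x"]) (auto intro: *)
qed

lemma
  assumes "smooth f"
  shows nderiv_cmult: "nderiv j (\<lambda>x. c * f x) = (\<lambda>x. c * nderiv j f x)"
    and smooth_cmult: "smooth (\<lambda>x. c * f x)"
proof -
  have *: "((\<lambda>x. c * nderiv j f x) has_vector_derivative c * nderiv (Suc j) f x) (at x)" for j x
    by (intro has_vector_derivative_mult_right smooth_has_vector_derivative assms)
  show "nderiv j (\<lambda>x. c * f x) = (\<lambda>x. c * nderiv j f x)"
    by (rule nderiv_sequence) (auto intro: *)
  show "smooth (\<lambda>x. c * f x)"
    by (rule smooth_sequence[where F="\<lambda>j x. c * nderiv j f x"]) (auto intro: *)
qed

lemma smooth_diff: "smooth f \<Longrightarrow> smooth g \<Longrightarrow> smooth (\<lambda>x. f x - g x)"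
  using smooth_add[of f "\<lambda>x. - 1 * g x"] smooth_cmult[of g "- 1"] by simp

lemma nderiv_diff:
  "smooth f \<Longrightarrow> smooth g \<Longrightarrow> nderiv j (\<lambda>x. f x - g x) = (\<lambda>x. nderiv j f x - nderiv j g x)"
  using nderiv_add[of f "\<lambda>x. - 1 * g x"] smooth_cmult[of g "- 1"] nderiv_cmult[of g j "- 1"]
  by simp

lemma
  shows smooth_zero: "smooth (\<lambda>x. 0)" and nderiv_zero: "nderiv j (\<lambda>x. 0) = (\<lambda>x. 0)"
  by (rule smooth_sequence[where F="\<lambda>j x. 0"] nderiv_sequence[where F="\<lambda>j x. 0"]; simp)+

lemma
  assumes "finite A" "\<And>i. i \<in> A \<Longrightarrow> smooth (f i)"
  shows smooth_sum: "smooth (\<lambda>x. \<Sum>i\<in>A. f i x)"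
    and nderiv_sum: "nderiv j (\<lambda>x. \<Sum>i\<in>A. f i x) = (\<lambda>x. \<Sum>i\<in>A. nderiv j (f i) x)"
  using assms
  by (induction A rule: finite_induct) (simp_all add: smooth_zero nderiv_zero smooth_add nderiv_add)

lemma
  assumes "smooth f"
  shows nderiv_affine: "nderiv j (\<lambda>x. f (s * x + t)) = (\<lambda>x. of_real (s ^ j) * nderiv j f (s * x + t))"
    and smooth_affine: "smooth (\<lambda>x. f (s * x + t))"
proof -
  have *: "((\<lambda>x. of_real (s ^ j) * nderiv j f (s * x + t)) has_vector_derivative
      of_real (s ^ Suc j) * nderiv (Suc j) f (s * x + t)) (at x)" for j x
  proof -
    have "((\<lambda>x. s * x + t) has_vector_derivative s) (at x)"
      by (auto intro!: derivative_eq_intros)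
    from vector_diff_chain_at[OF this smooth_has_vector_derivative[OF assms, of j]]
    have "((\<lambda>x. nderiv j f (s * x + t)) has_vector_derivative
        s *\<^sub>R nderiv (Suc j) f (s * x + t)) (at x)"
      by (simp add: o_def)
    from has_vector_derivative_mult_right[OF this, of "of_real (s ^ j)"] show ?thesis
      by (simp add: scaleR_conv_of_real mult_ac)
  qed
  show "nderiv j (\<lambda>x. f (s * x + t)) = (\<lambda>x. of_real (s ^ j) * nderiv j f (s * x + t))"
    by (rule nderiv_sequence[where F="\<lambda>j x. of_real (s ^ j) * nderiv j f (s * x + t)", OF _ *]) simp
  show "smooth (\<lambda>x. f (s * x + t))"
    by (rule smooth_sequence[where F="\<lambda>j x. of_real (s ^ j) * nderiv j f (s * x + t)", OF _ *]) simp
qed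

lemma smooth_reflect: "smooth f \<Longrightarrow> smooth (\<lambda>y. f (x - y))"
  using smooth_affine[of f "- 1" x] by simp

lemma nderiv_reflect:
  "smooth f \<Longrightarrow> nderiv j (\<lambda>y. f (x - y)) = (\<lambda>y. (- 1) ^ j * nderiv j f (x - y))"
  using nderiv_affine[of f j "- 1" x] by simp

lemma
  assumes "smooth f" "smooth g"
  shows nderiv_mult: "nderiv n (\<lambda>x. f x * g x) =
      (\<lambda>x. \<Sum>i\<le>n. of_nat (n choose i) * nderiv i f x * nderiv (n - i) g x)"
    and smooth_mult: "smooth (\<lambda>x. f x * g x)"
proof -
  let ?F = "\<lambda>n x. \<Sum>i\<le>n. of_nat (n choose i) * nderiv i f x * nderiv (n - i) g x"
  have *: "(?F n has_vector_derivative ?F (Suc n) x) (at x)" for n x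
  proof -
    have "(?F n has_vector_derivative (\<Sum>i\<le>n. of_nat (n choose i) *
        (nderiv i f x * nderiv (Suc (n - i)) g x + nderiv (Suc i) f x * nderiv (n - i) g x))) (at x)"
      unfolding mult.assoc
      by (intro has_vector_derivative_sum has_vector_derivative_mult_right
          has_vector_derivative_mult smooth_has_vector_derivative assms)
    moreover have "(\<Sum>i\<le>n. of_nat (n choose i) *
        (nderiv i f x * nderiv (Suc (n - i)) g x + nderiv (Suc i) f x * nderiv (n - i) g x)) = ?F (Suc n) x"
    proof -
      have "?F (Suc n) x = f x * nderiv (Suc n) g x + (\<Sum>i\<le>n. of_nat (Suc n choose Suc i) *
          nderiv (Suc i) f x * nderiv (n - i) g x)"
        by (subst sum.atMost_Suc_shift) simp
      also have "\<dots> = f x * nderiv (Suc n) g x + (\<Sum>i\<le>n. of_nat (n choose Suc i) *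
          nderiv (Suc i) f x * nderiv (n - i) g x) + (\<Sum>i\<le>n. of_nat (n choose i) *
          nderiv (Suc i) f x * nderiv (n - i) g x)"
        by (simp add: sum.distrib algebra_simps)
      also have "f x * nderiv (Suc n) g x + (\<Sum>i\<le>n. of_nat (n choose Suc i) *
          nderiv (Suc i) f x * nderiv (n - i) g x) =
          (\<Sum>i\<le>Suc n. of_nat (n choose i) * nderiv i f x * nderiv (Suc n - i) g x)"
        by (subst sum.atMost_Suc_shift) simp
      \<comment> \<open>The additional term \<open>i = Suc n\<close> has the coefficient
        \<open>n choose Suc n = 0\<close>.\<close>
      also have "\<dots> = (\<Sum>i\<le>n. of_nat (n choose i) * nderiv i f x * nderiv (Suc (n - i)) g x)"
        by (simp add: Suc_diff_le)
      finally show ?thesis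
        by (simp add: sum.distrib algebra_simps)
    qed
    ultimately show ?thesis by simp
  qed
  show "nderiv n (\<lambda>x. f x * g x) = ?F n"
    by (rule nderiv_sequence[where F="?F", OF _ *]) simp
  show "smooth (\<lambda>x. f x * g x)"
    by (rule smooth_sequence[where F="?F", OF _ *]) simp
qed

section \<open>Mean value and Taylor estimates on segments of either orientation\<close>

lemma nderiv_diff_bound:
  assumes "smooth f" "\<And>t. t \<in> closed_segment a b \<Longrightarrow> norm (nderiv (Suc j) f t) \<le> B"
  shows "norm (nderiv j f b - nderiv j f a) \<le> B * \<bar>b - a\<bar>"
proof -
  have "norm (nderiv j f b - nderiv j f a) \<le> B * norm (b - a)"
  proof (rule differentiable_bound[of "closed_segment a b" _ "\<lambda>t h. h *\<^sub>R nderiv (Suc j) f t"])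
    show "(nderiv j f has_derivative (\<lambda>h. h *\<^sub>R nderiv (Suc j) f t)) (at t within closed_segment a b)"
      for t
      using smooth_has_vector_derivative[OF assms(1), of j t]
      by (auto simp: has_vector_derivative_def intro: has_derivative_at_withinI)
    show "onorm (\<lambda>h. h *\<^sub>R nderiv (Suc j) f t) \<le> B" if "t \<in> closed_segment a b" for t
      using assms(2)[OF that] by (simp add: onorm_scaleR_left[OF bounded_linear_ident] onorm_id)
  qed auto
  then show ?thesis by simp
qed

text \<open>The mean value inequality is used twice, for the derivative and then for the remainder.
  This gives the factor 1 in place of Taylor's 1/2; later only the order
  \<open>(b - a)\<^sup>2\<close> matters.\<close>

lemma nderiv_taylor_bound:
  assumes "smooth f" "\<And>t. t \<in> closed_segment a b \<Longrightarrow> norm (nderiv (Suc (Suc j)) f t) \<le> B"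
  shows "norm (nderiv j f b - nderiv j f a - of_real (b - a) * nderiv (Suc j) f a) \<le> B * (b - a)\<^sup>2"
proof -
  have "norm (nderiv j f b - nderiv j f a - (b - a) *\<^sub>R nderiv (Suc j) f a) \<le> norm (b - a) * (B * \<bar>b - a\<bar>)"
  proof (rule differentiable_bound_linearization[of a b "closed_segment a b" _ "\<lambda>t h. h *\<^sub>R nderiv (Suc j) f t"])
    show "a + t *\<^sub>R (b - a) \<in> closed_segment a b" if "t \<in> {0..1}" for t
      using that unfolding closed_segment_def by (auto intro!: exI[of _ t] simp: algebra_simps)
    show "(nderiv j f has_derivative (\<lambda>h. h *\<^sub>R nderiv (Suc j) f t)) (at t within closed_segment a b)"
      for t
      using smooth_has_vector_derivative[OF assms(1), of j t]
      by (auto simp: has_vector_derivative_def intro: has_derivative_at_withinI)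
    show "onorm ((\<lambda>h. h *\<^sub>R nderiv (Suc j) f t) - (\<lambda>h. h *\<^sub>R nderiv (Suc j) f a)) \<le> B * \<bar>b - a\<bar>"
      if t: "t \<in> closed_segment a b" for t
    proof -
      have "0 \<le> B" using assms(2)[OF t] norm_ge_zero by (rule order_trans[rotated])
      have "norm (nderiv (Suc j) f t - nderiv (Suc j) f a) \<le> B * \<bar>t - a\<bar>"
        by (rule nderiv_diff_bound[OF assms(1)])
          (use assms(2) t subset_closed_segment[of a t a b] in auto)
      also have "\<dots> \<le> B * \<bar>b - a\<bar>"
        using t \<open>0 \<le> B\<close> by (intro mult_left_mono) (auto simp: closed_segment_eq_real_ivl split: if_splits)
      finally show ?thesis
        by (simp add: fun_diff_def scaleR_diff_right[symmetric] onorm_scaleR_left[OF bounded_linear_ident] onorm_id)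
    qed
  qed auto
  then show ?thesis by (simp add: scaleR_conv_of_real power2_eq_square mult_ac)
qed

section \<open>Integrable smooth functions and bounded distributions\<close>

lemma
  shows integrable_inverse_square_weight: "integrable lborel (\<lambda>y::real. 1 / (1 + (x - y)\<^sup>2))"
    and integral_inverse_square_weight: "(LINT y|lborel. 1 / (1 + (x - y)\<^sup>2)) = pi"
proof -
  let ?w = "\<lambda>y::real. 1 / (1 + y\<^sup>2)"
  have w: "integrable lborel ?w" "(LINT y|lborel. ?w y) = pi"
    using integrable_inverse_1_plus_square LBINT_inverse_1_plus_square
    by (simp_all add: set_integrable_def interval_lebesgue_integral_def set_lebesgue_integral_def
        inverse_eq_divide)
  show "integrable lborel (\<lambda>y::real. 1 / (1 + (x - y)\<^sup>2))"
    using lborel_integrable_real_affine[OF w(1), of "- 1" x] by simp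
  show "(LINT y|lborel. 1 / (1 + (x - y)\<^sup>2)) = pi"
    using lborel_integral_real_affine[of "- 1" ?w x] w(2) by simp
qed

text \<open>A case of Peetre's inequality: the difference of the two sides is a sum of
  squares.\<close>

lemma peetre_bound: "(1 + x\<^sup>2) \<le> 2 * (1 + s\<^sup>2) * (1 + (x + s)\<^sup>2)" for x s :: real
proof -
  have "2 * (1 + s\<^sup>2) * (1 + (x + s)\<^sup>2) - (1 + x\<^sup>2) = 1 + (x + 2 * s)\<^sup>2 + 2 * (s * (x + s))\<^sup>2"
    by (simp add: power2_eq_square algebra_simps)
  moreover have "0 \<le> \<dots>" by simp
  ultimately show ?thesis by linarith
qed

text \<open>Recentres the weight at a fixed point; the price is a factor that depends on the shift
  \<open>s\<close> alone.\<close>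

lemma weight_shift:
  fixes B x s :: real
  assumes "0 \<le> B"
  shows "B / (1 + (x + s)\<^sup>2) \<le> 2 * (1 + s\<^sup>2) * B / (1 + x\<^sup>2)"
proof -
  have "B * (1 + x\<^sup>2) \<le> B * (2 * (1 + s\<^sup>2) * (1 + (x + s)\<^sup>2))"
    by (intro mult_left_mono peetre_bound assms)
  moreover have "0 < 1 + x\<^sup>2" "0 < 1 + (x + s)\<^sup>2" by (auto intro: add_pos_nonneg)
  ultimately show ?thesis by (simp add: divide_simps mult_ac)
qed

section \<open>The space \<open>DLp 1\<close> and its norms\<close>

lemma smooth_measurable: "smooth f \<Longrightarrow> nderiv j f \<in> borel_measurable lborel"
  using smooth_continuous_on[of f UNIV j] by (simp add: borel_measurable_continuous_onI)

lemma DLp_1_iff: "\<phi> \<in> DLp 1 \<longleftrightarrow> smooth \<phi> \<and> (\<forall>j. integrable lborel (nderiv j \<phi>))"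
  using smooth_measurable[of \<phi>] by (auto simp: DLp_def Lp_space_def integrable_norm_iff)

lemma DLp_norm_1: "DLp_norm k 1 \<phi> = (\<Sum>j\<le>k. LINT x|lborel. norm (nderiv j \<phi> x))"
  by (simp add: DLp_norm_def Lp_norm_def)

lemma DLp_norm_1_nonneg: "0 \<le> DLp_norm k 1 \<phi>"
  by (simp add: DLp_norm_1 sum_nonneg)

lemma DLp_1_smooth: "\<phi> \<in> DLp 1 \<Longrightarrow> smooth \<phi>"
  by (simp add: DLp_1_iff)

lemma DLp_1_add: "\<phi> \<in> DLp 1 \<Longrightarrow> \<psi> \<in> DLp 1 \<Longrightarrow> (\<lambda>x. \<phi> x + \<psi> x) \<in> DLp 1"
  by (simp add: DLp_1_iff nderiv_add smooth_add)

lemma DLp_1_diff: "\<phi> \<in> DLp 1 \<Longrightarrow> \<psi> \<in> DLp 1 \<Longrightarrow> (\<lambda>x. \<phi> x - \<psi> x) \<in> DLp 1"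
  by (simp add: DLp_1_iff nderiv_diff smooth_diff)

lemma DLp_1_cmult: "\<phi> \<in> DLp 1 \<Longrightarrow> (\<lambda>x. c * \<phi> x) \<in> DLp 1"
  by (simp add: DLp_1_iff nderiv_cmult smooth_cmult)

lemma DLp_1_zero: "(\<lambda>x. 0) \<in> DLp 1"
  by (simp add: DLp_1_iff nderiv_zero smooth_zero)

lemma DLp_1_sum: "finite A \<Longrightarrow> (\<And>i. i \<in> A \<Longrightarrow> f i \<in> DLp 1) \<Longrightarrow> (\<lambda>x. \<Sum>i\<in>A. f i x) \<in> DLp 1"
  by (induction A rule: finite_induct) (simp_all add: DLp_1_zero DLp_1_add)

lemma DLp_1_nderiv: "\<phi> \<in> DLp 1 \<Longrightarrow> nderiv j \<phi> \<in> DLp 1"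
  by (simp add: DLp_1_iff nderiv_nderiv smooth_nderiv)

lemma DLp_1_reflect:
  assumes "\<phi> \<in> DLp 1"
  shows "(\<lambda>y. \<phi> (x - y)) \<in> DLp 1"
proof -
  have "integrable lborel (\<lambda>y. (- 1) ^ j * nderiv j \<phi> (x - y))" for j
    using lborel_integrable_real_affine[of "nderiv j \<phi>" "- 1" x] assms
    by (simp add: DLp_1_iff)
  then show ?thesis
    using assms by (simp add: DLp_1_iff nderiv_reflect smooth_reflect)
qed

lemma DLp_norm_1_reflect:
  assumes "smooth \<phi>"
  shows "DLp_norm k 1 (\<lambda>y. \<phi> (x - y)) = DLp_norm k 1 \<phi>"
proof -
  have "(LINT y|lborel. norm (nderiv j \<phi> (x - y))) = (LINT y|lborel. norm (nderiv j \<phi> y))" for j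
    using lborel_integral_real_affine[of "- 1" "\<lambda>y. norm (nderiv j \<phi> y)" x] by simp
  then show ?thesis
    by (simp add: DLp_norm_1 nderiv_reflect[OF assms] norm_mult norm_power)
qed

lemma DLp_norm_1_cmult: "smooth \<phi> \<Longrightarrow> DLp_norm k 1 (\<lambda>x. c * \<phi> x) = norm c * DLp_norm k 1 \<phi>"
  by (simp add: DLp_norm_1 nderiv_cmult norm_mult sum_distrib_left)

lemma DLp_norm_1_nderiv: "DLp_norm k 1 (nderiv j \<phi>) \<le> DLp_norm (k + j) 1 \<phi>"
proof -
  have "DLp_norm k 1 (nderiv j \<phi>) = (\<Sum>i\<in>(\<lambda>i. i + j) ` {..k}. LINT x|lborel. norm (nderiv i \<phi> x))"
    by (simp add: DLp_norm_1 nderiv_nderiv sum.reindex)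
  also have "\<dots> \<le> DLp_norm (k + j) 1 \<phi>"
    unfolding DLp_norm_1 by (intro sum_mono2) auto
  finally show ?thesis .
qed

text \<open>The centre \<open>x\<close> is free and absent from the integral bound, so functions of
  the form \<open>\<psi>(x - y)\<close> are estimated uniformly in \<open>x\<close>.\<close>

lemma
  fixes f :: "real \<Rightarrow> complex"
  assumes "f \<in> borel_measurable lborel" "\<And>y. norm (f y) \<le> B / (1 + (x - y)\<^sup>2)"
  shows integrable_weight_bound: "integrable lborel f"
    and integral_weight_bound: "(LINT y|lborel. norm (f y)) \<le> B * pi"
proof -
  have w: "integrable lborel (\<lambda>y. B / (1 + (x - y)\<^sup>2))"
    using integrable_mult_right[OF integrable_inverse_square_weight, of B x] by simp
  have "norm (f y) \<le> norm (B / (1 + (x - y)\<^sup>2))" for y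
    using assms(2)[of y] abs_ge_self by (metis real_norm_def order_trans)
  then show f: "integrable lborel f"
    by (intro Bochner_Integration.integrable_bound[OF w] assms(1) AE_I2)
  have "(LINT y|lborel. norm (f y)) \<le> (LINT y|lborel. B / (1 + (x - y)\<^sup>2))"
    by (intro integral_mono integrable_norm f w assms)
  also have "\<dots> = B * pi"
    using integral_inverse_square_weight[of x]
      integral_mult_right_zero[of lborel B "\<lambda>y. 1 / (1 + (x - y)\<^sup>2)"] by simp
  finally show "(LINT y|lborel. norm (f y)) \<le> B * pi" .
qed

lemma DLp_norm_1_weight_bound:
  assumes "smooth \<phi>" "\<And>j y. j \<le> k \<Longrightarrow> norm (nderiv j \<phi> y) \<le> B / (1 + (x - y)\<^sup>2)"
  shows "DLp_norm k 1 \<phi> \<le> real (Suc k) * (B * pi)"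
proof -
  have "DLp_norm k 1 \<phi> \<le> (\<Sum>j\<le>k. B * pi)"
    unfolding DLp_norm_1
    by (intro sum_mono integral_weight_bound[where x=x] smooth_measurable assms) auto
  then show ?thesis by simp
qed

text \<open>Contains the test functions and the Schwartz functions; the single integrable weight
  \<open>1 / (1 + y\<^sup>2)\<close> is all that the \<open>L\<^sup>1\<close> estimates need.\<close>

definition decaying :: "(real \<Rightarrow> complex) set" where
  "decaying = {f. smooth f \<and> (\<forall>j. \<exists>C. \<forall>y. norm (nderiv j f y) \<le> C / (1 + y\<^sup>2))}"

lemma decaying_smooth: "f \<in> decaying \<Longrightarrow> smooth f"
  by (simp add: decaying_def)

text \<open>A norm of order \<open>k\<close> involves finitely many derivatives, so the sum of their
  constants serves all of them at once.\<close>

lemma decaying_bound: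
  assumes "f \<in> decaying"
  obtains B where "0 \<le> B" "\<And>j y. j \<le> k \<Longrightarrow> norm (nderiv j f y) \<le> B / (1 + y\<^sup>2)"
proof -
  obtain C where C: "norm (nderiv j f y) \<le> C j / (1 + y\<^sup>2)" for j y
    using assms unfolding decaying_def by (auto dest!: choice)
  show thesis
  proof
    show "0 \<le> (\<Sum>j\<le>k. \<bar>C j\<bar>)" by (simp add: sum_nonneg)
    show "norm (nderiv j f y) \<le> (\<Sum>j\<le>k. \<bar>C j\<bar>) / (1 + y\<^sup>2)" if "j \<le> k" for j y
    proof -
      have "C j \<le> (\<Sum>j\<le>k. \<bar>C j\<bar>)"
        using member_le_sum[of j "{..k}" "\<lambda>j. \<bar>C j\<bar>"] that by auto
      then show ?thesis
        using C[of j y] by (auto intro!: order_trans[OF C] divide_right_mono)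
    qed
  qed
qed

lemma decaying_nderiv: "f \<in> decaying \<Longrightarrow> nderiv j f \<in> decaying"
  by (simp add: decaying_def smooth_nderiv nderiv_nderiv)

lemma decaying_bounded:
  assumes "f \<in> decaying"
  obtains M where "0 \<le> M" "\<And>x. norm (nderiv j f x) \<le> M"
proof -
  obtain B where B: "0 \<le> B" "\<And>i y. i \<le> j \<Longrightarrow> norm (nderiv i f y) \<le> B / (1 + y\<^sup>2)"
    by (rule decaying_bound[OF assms]) (rule that)
  have "B / (1 + y\<^sup>2) \<le> B / 1" for y
    using B(1) by (intro divide_left_mono) (auto intro: add_pos_nonneg)
  then show thesis
    using that[of B] B by (metis order.refl order_trans div_by_1)
qed

lemma decaying_DLp_1: "f \<in> decaying \<Longrightarrow> f \<in> DLp 1"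
  unfolding DLp_1_iff
proof safe
  fix j assume f: "f \<in> decaying"
  show "smooth f" using f by (rule decaying_smooth)
  obtain B where "\<And>i y. i \<le> j \<Longrightarrow> norm (nderiv i f y) \<le> B / (1 + y\<^sup>2)"
    by (rule decaying_bound[OF f]) (rule that)
  then show "integrable lborel (nderiv j f)"
    by (intro integrable_weight_bound[where x=0 and B=B] smooth_measurable decaying_smooth f) auto
qed

lemma decaying_cmult:
  assumes "f \<in> decaying" shows "(\<lambda>x. c * f x) \<in> decaying"
  unfolding decaying_def
proof safe
  show "smooth (\<lambda>x. c * f x)" using assms by (simp add: decaying_smooth smooth_cmult)
  fix j
  obtain C where "\<And>i y. i \<le> j \<Longrightarrow> norm (nderiv i f y) \<le> C / (1 + y\<^sup>2)"
    by (rule decaying_bound[OF assms]) (rule that)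
  then have "norm c * norm (nderiv j f y) \<le> norm c * (C / (1 + y\<^sup>2))" for y
    by (intro mult_left_mono) auto
  then show "\<exists>C. \<forall>y. norm (nderiv j (\<lambda>x. c * f x) y) \<le> C / (1 + y\<^sup>2)"
    by (intro exI[of _ "norm c * C"]) (simp add: nderiv_cmult[OF decaying_smooth[OF assms]] norm_mult)
qed

lemma decaying_scale:
  assumes "f \<in> decaying" "s \<noteq> 0" shows "(\<lambda>x. f (s * x)) \<in> decaying"
  unfolding decaying_def
proof safe
  have s: "smooth f" using assms(1) by (rule decaying_smooth)
  show "smooth (\<lambda>x. f (s * x))" using smooth_affine[OF s, of s 0] by simp
  fix j
  obtain C where C: "0 \<le> C" "\<And>i y. i \<le> j \<Longrightarrow> norm (nderiv i f y) \<le> C / (1 + y\<^sup>2)"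
    by (rule decaying_bound[OF assms(1)]) (rule that)
  have "norm (of_real (s ^ j) * nderiv j f (s * y)) \<le> (\<bar>s ^ j\<bar> * C * (1 + 1 / s\<^sup>2)) / (1 + y\<^sup>2)" for y
  proof -
    \<comment> \<open>The factor \<open>1 + 1 / s\<^sup>2\<close> is chosen so that
      \<open>1 / s\<^sup>2\<close> times \<open>(s * y)\<^sup>2\<close> reproduces
      \<open>y\<^sup>2\<close>.\<close>
    have *: "1 + y\<^sup>2 \<le> (1 + 1 / s\<^sup>2) * (1 + (s * y)\<^sup>2)"
    proof -
      have "(1 + 1 / s\<^sup>2) * (1 + (s * y)\<^sup>2) = 1 + y\<^sup>2 + 1 / s\<^sup>2 + (s * y)\<^sup>2"
        using assms(2) by (simp add: power_mult_distrib field_simps)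
      moreover have "0 \<le> 1 / s\<^sup>2" "0 \<le> (s * y)\<^sup>2" by simp_all
      ultimately show ?thesis by linarith
    qed
    have "C / (1 + (s * y)\<^sup>2) \<le> C * (1 + 1 / s\<^sup>2) / (1 + y\<^sup>2)"
      using mult_left_mono[OF * C(1)] add_pos_nonneg[OF zero_less_one zero_le_power2[of y]]
        add_pos_nonneg[OF zero_less_one zero_le_power2[of "s * y"]]
      by (simp only: pos_divide_le_eq pos_le_divide_eq times_divide_eq_left mult.assoc)
    then have "norm (nderiv j f (s * y)) \<le> C * (1 + 1 / s\<^sup>2) / (1 + y\<^sup>2)"
      using C(2)[of j "s * y"] by auto
    from mult_left_mono[OF this abs_ge_zero[of "s ^ j"]] show ?thesis
      by (simp add: norm_mult norm_power mult_ac power_abs)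
  qed
  then show "\<exists>C. \<forall>y. norm (nderiv j (\<lambda>x. f (s * x)) y) \<le> C / (1 + y\<^sup>2)"
    using nderiv_affine[OF s, of j s 0] by (intro exI) auto
qed

section \<open>Schwartz functions and test functions are decaying\<close>

lemma schwartz_power_bound:
  assumes "f \<in> schwartz_space"
  obtains C where "0 \<le> C" "\<And>y. \<bar>y\<bar> ^ m * norm (nderiv j f y) \<le> C"
proof -
  have "bounded (range (\<lambda>x. x ^ m *\<^sub>R nderiv j f x))"
    using assms by (simp add: schwartz_space_def)
  then obtain C where C: "\<And>y. norm (y ^ m *\<^sub>R nderiv j f y) \<le> C"
    unfolding bounded_iff by auto
  have "0 \<le> C" using norm_ge_zero C by (rule order_trans)
  with that[of C] C show thesis by (simp add: power_abs)
qed

lemma schwartz_decaying: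
  assumes "f \<in> schwartz_space" shows "f \<in> decaying"
  unfolding decaying_def
proof safe
  show "smooth f" using assms by (simp add: schwartz_space_def)
  fix j
  obtain C where C: "\<And>y. \<bar>y\<bar> ^ 0 * norm (nderiv j f y) \<le> C"
    by (rule schwartz_power_bound[OF assms]) (rule that)
  obtain D where D: "\<And>y. \<bar>y\<bar> ^ 2 * norm (nderiv j f y) \<le> D"
    by (rule schwartz_power_bound[OF assms]) (rule that)
  have "norm (nderiv j f y) \<le> (C + D) / (1 + y\<^sup>2)" for y
    using C[of y] D[of y] add_pos_nonneg[OF zero_less_one zero_le_power2[of y]]
    by (simp add: pos_le_divide_eq algebra_simps)
  then show "\<exists>C. \<forall>y. norm (nderiv j f y) \<le> C / (1 + y\<^sup>2)" by blast
qed

text \<open>Prepared for \<open>mollify_approximation\<close>: there \<open>\<bar>z\<bar>\<close>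
  arises from the mean value inequality and \<open>1 + z\<^sup>2\<close> from recentring the weight.
  One more factor \<open>1 + z\<^sup>2\<close> secures integrability, and the product expands into
  the powers 1, 3 and 5 of \<open>\<bar>z\<bar>\<close>.\<close>

lemma schwartz_moment_bound:
  assumes "f \<in> schwartz_space"
  obtains D where "0 \<le> D" "\<And>z. norm (f z) * (\<bar>z\<bar> * (1 + z\<^sup>2)) \<le> D / (1 + z\<^sup>2)"
proof -
  obtain C1 where C1: "0 \<le> C1" "\<And>y. \<bar>y\<bar> ^ 1 * norm (nderiv 0 f y) \<le> C1"
    by (rule schwartz_power_bound[OF assms]) (rule that)
  obtain C3 where C3: "0 \<le> C3" "\<And>y. \<bar>y\<bar> ^ 3 * norm (nderiv 0 f y) \<le> C3"
    by (rule schwartz_power_bound[OF assms]) (rule that)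
  obtain C5 where C5: "0 \<le> C5" "\<And>y. \<bar>y\<bar> ^ 5 * norm (nderiv 0 f y) \<le> C5"
    by (rule schwartz_power_bound[OF assms]) (rule that)
  have "norm (f z) * (\<bar>z\<bar> * (1 + z\<^sup>2)) \<le> (C1 + 2 * C3 + C5) / (1 + z\<^sup>2)" for z
  proof -
    have "norm (f z) * (\<bar>z\<bar> * (1 + z\<^sup>2)) * (1 + z\<^sup>2) =
        \<bar>z\<bar> ^ 1 * norm (f z) + 2 * (\<bar>z\<bar> ^ 3 * norm (f z)) + \<bar>z\<bar> ^ 5 * norm (f z)"
      unfolding power2_abs[of z, symmetric] by (simp add: eval_nat_numeral algebra_simps)
    also have "\<dots> \<le> C1 + 2 * C3 + C5"
      using C1(2)[of z] C3(2)[of z] C5(2)[of z] by simp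
    finally show ?thesis
      using add_pos_nonneg[OF zero_less_one zero_le_power2[of z]] by (simp add: pos_le_divide_eq)
  qed
  moreover have "0 \<le> C1 + 2 * C3 + C5" using C1(1) C3(1) C5(1) by simp
  ultimately show thesis by (rule that[rotated])
qed

lemma test_function_smooth: "\<phi> \<in> test_functions \<Longrightarrow> smooth \<phi>"
  by (simp add: test_functions_def)

lemma nderiv_eq_0_outside:
  assumes "\<And>x. R < \<bar>x\<bar> \<Longrightarrow> \<phi> x = 0" "R < \<bar>x\<bar>"
  shows "nderiv j \<phi> x = 0"
  using assms(2)
proof (induction j arbitrary: x)
  case (Suc j)
  have "open {x. R < \<bar>x\<bar>}" by (intro open_Collect_less continuous_intros)
  then have "(nderiv j \<phi> has_vector_derivative 0) (at x)"
    by (rule has_vector_derivative_transform_within_open[where f="\<lambda>_. 0", OF has_vector_derivative_const])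
      (use Suc in auto)
  then show ?case by (simp add: nderiv_Suc vector_derivative_at)
qed (use assms(1) in simp)

lemma test_function_support:
  assumes "\<phi> \<in> test_functions"
  obtains R where "0 < R" "\<And>j x. R < \<bar>x\<bar> \<Longrightarrow> nderiv j \<phi> x = 0"
proof -
  have "bounded {x. \<phi> x \<noteq> 0}"
    using assms by (auto simp: test_functions_def compact_closure)
  then obtain R where R: "0 < R" "\<And>x. \<phi> x \<noteq> 0 \<Longrightarrow> \<bar>x\<bar> \<le> R"
    by (auto simp: bounded_pos)
  then have "\<phi> x = 0" if "R < \<bar>x\<bar>" for x
    using that by fastforce
  then show thesis
    using that[OF R(1)] nderiv_eq_0_outside[of R \<phi>] by blast
qed

lemma test_functionI:
  assumes "smooth \<phi>" "\<And>x. R < \<bar>x\<bar> \<Longrightarrow> \<phi> x = 0"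
  shows "\<phi> \<in> test_functions"
proof -
  have "bounded {x. \<phi> x \<noteq> 0}"
    using assms(2) by (intro boundedI[of _ R]) (auto simp: not_less[symmetric])
  then show ?thesis using assms(1) by (simp add: test_functions_def compact_closure)
qed

lemma test_function_nderiv: "\<phi> \<in> test_functions \<Longrightarrow> nderiv j \<phi> \<in> test_functions"
  by (rule test_function_support, assumption)
    (auto intro: test_functionI smooth_nderiv test_function_smooth)

lemma test_function_decaying:
  assumes "\<phi> \<in> test_functions" shows "\<phi> \<in> decaying"
  unfolding decaying_def
proof safe
  show s: "smooth \<phi>" using assms by (rule test_function_smooth)
  fix j
  obtain R where R: "0 < R" "\<And>j x. R < \<bar>x\<bar> \<Longrightarrow> nderiv j \<phi> x = 0"
    by (rule test_function_support[OF assms]) (rule that)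
  have "compact (nderiv j \<phi> ` {- R..R})"
    by (intro compact_continuous_image smooth_continuous_on s compact_Icc)
  then obtain M where M: "0 < M" "\<And>x. x \<in> {- R..R} \<Longrightarrow> norm (nderiv j \<phi> x) \<le> M"
    using compact_imp_bounded[of "nderiv j \<phi> ` {- R..R}"] unfolding bounded_pos by blast
  have "norm (nderiv j \<phi> y) \<le> M * (1 + R\<^sup>2) / (1 + y\<^sup>2)" for y
  proof (cases "R < \<bar>y\<bar>")
    case True
    then show ?thesis using R(2) M(1) by (simp add: add_nonneg_nonneg)
  next
    case False
    then have "y\<^sup>2 \<le> R\<^sup>2" by (simp add: abs_le_square_iff[symmetric])
    then have "M * (1 + y\<^sup>2) \<le> M * (1 + R\<^sup>2)" using M(1) by simp
    then have "M \<le> M * (1 + R\<^sup>2) / (1 + y\<^sup>2)"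
      using add_pos_nonneg[OF zero_less_one zero_le_power2[of y]] by (simp add: pos_le_divide_eq)
    moreover have "norm (nderiv j \<phi> y) \<le> M" using False by (intro M) auto
    ultimately show ?thesis by simp
  qed
  then show "\<exists>C. \<forall>y. norm (nderiv j \<phi> y) \<le> C / (1 + y\<^sup>2)" by blast
qed

section \<open>Bounded distributions and the norm estimate behind their continuity\<close>

lemma
  assumes "T \<in> bounded_distributions"
  shows dist_plus: "\<phi> \<in> DLp 1 \<Longrightarrow> \<psi> \<in> DLp 1 \<Longrightarrow> T (\<lambda>x. \<phi> x + \<psi> x) = T \<phi> + T \<psi>"
    and dist_cmult: "\<phi> \<in> DLp 1 \<Longrightarrow> T (\<lambda>x. c * \<phi> x) = c * T \<phi>"
    and dist_extensional: "T \<in> extensional (DLp 1)"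
  using assms by (auto simp: bounded_distributions_def)

lemma dist_zero: "T \<in> bounded_distributions \<Longrightarrow> T (\<lambda>x. 0) = 0"
  using dist_cmult[OF _ DLp_1_zero, of T 0] by simp

lemma dist_minus:
  assumes "T \<in> bounded_distributions" "\<phi> \<in> DLp 1" "\<psi> \<in> DLp 1"
  shows "T (\<lambda>x. \<phi> x - \<psi> x) = T \<phi> - T \<psi>"
  using dist_plus[OF assms(1,2) DLp_1_cmult[OF assms(3), of "- 1"]] dist_cmult[OF assms(1,3), of "- 1"]
  by simp

lemma dist_sum:
  assumes "T \<in> bounded_distributions" "finite A" "\<And>i. i \<in> A \<Longrightarrow> f i \<in> DLp 1"
  shows "T (\<lambda>x. \<Sum>i\<in>A. f i x) = (\<Sum>i\<in>A. T (f i))"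
  using assms(2,3)
proof (induction A rule: finite_induct)
  case (insert x F)
  then have "f x \<in> DLp 1" "(\<lambda>x. \<Sum>i\<in>F. f i x) \<in> DLp 1"
    by (auto intro: DLp_1_sum)
  with insert show ?case by (simp add: dist_plus[OF assms(1)])
qed (simp add: dist_zero[OF assms(1)])

text \<open>Continuity at 0 gives a ball on which \<open>T\<close> is below 1, and scaling spreads
  this to an estimate on the whole space.\<close>

lemma bounded_distribution_bound:
  assumes "T \<in> bounded_distributions"
  obtains k C where "0 \<le> C" "\<And>\<phi>. \<phi> \<in> DLp 1 \<Longrightarrow> norm (T \<phi>) \<le> C * DLp_norm k 1 \<phi>"
proof -
  have "\<forall>\<phi>\<in>DLp 1. \<forall>e>0. \<exists>k. \<exists>d>0. \<forall>\<psi>\<in>DLp 1.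
        DLp_norm k 1 (\<lambda>x. \<psi> x - \<phi> x) < d \<longrightarrow> norm (T \<psi> - T \<phi>) < e"
    using assms by (simp add: bounded_distributions_def)
  from this[rule_format, OF DLp_1_zero zero_less_one] obtain k d where
    kd: "0 < d" "\<And>\<psi>. \<psi> \<in> DLp 1 \<Longrightarrow> DLp_norm k 1 \<psi> < d \<Longrightarrow> norm (T \<psi>) < 1"
    by (auto simp: dist_zero[OF assms])
  have "norm (T \<phi>) \<le> 1 / d * DLp_norm k 1 \<phi>" if \<phi>: "\<phi> \<in> DLp 1" for \<phi>
  proof -
    \<comment> \<open>The scaling uses any \<open>r\<close> above the norm, since the norm itself
      could be 0 and must not be divided by. Letting \<open>r\<close> decrease to it gives the
      bound.\<close>
    have "d * norm (T \<phi>) \<le> r" if r: "DLp_norm k 1 \<phi> < r" for r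
    proof -
      have "0 < r" using DLp_norm_1_nonneg[of k \<phi>] r by simp
      have "DLp_norm k 1 (\<lambda>x. of_real (d / r) * \<phi> x) = d / r * DLp_norm k 1 \<phi>"
        using DLp_norm_1_cmult[OF DLp_1_smooth[OF \<phi>], of k "of_real (d / r)"] \<open>0 < r\<close> kd(1)
        by (simp add: norm_divide)
      also have "\<dots> < d" using r \<open>0 < r\<close> kd(1) by (simp add: field_simps)
      finally have "norm (T (\<lambda>x. of_real (d / r) * \<phi> x)) < 1"
        by (intro kd(2) DLp_1_cmult \<phi>)
      then show ?thesis
        using \<open>0 < r\<close> kd(1) by (simp only: dist_cmult[OF assms \<phi>] norm_mult norm_of_real)
          (simp add: field_simps)
    qed
    then have "d * norm (T \<phi>) \<le> DLp_norm k 1 \<phi>"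
      by (rule dense_ge)
    then show ?thesis using kd(1) by (simp add: field_simps)
  qed
  then show thesis using kd(1) by (intro that[of "1 / d" k]) auto
qed

lemma bounded_distributionI:
  assumes "T \<in> extensional (DLp 1)"
    and "\<And>\<phi> \<psi>. \<phi> \<in> DLp 1 \<Longrightarrow> \<psi> \<in> DLp 1 \<Longrightarrow> T (\<lambda>x. \<phi> x + \<psi> x) = T \<phi> + T \<psi>"
    and cmult: "\<And>c \<phi>. \<phi> \<in> DLp 1 \<Longrightarrow> T (\<lambda>x. c * \<phi> x) = c * T \<phi>"
    and bound: "\<And>\<phi>. \<phi> \<in> DLp 1 \<Longrightarrow> norm (T \<phi>) \<le> C * DLp_norm k 1 \<phi>"
  shows "T \<in> bounded_distributions"
proof -
  have "\<exists>d>0. \<forall>\<psi>\<in>DLp 1. DLp_norm k 1 (\<lambda>x. \<psi> x - \<phi> x) < d \<longrightarrow> norm (T \<psi> - T \<phi>) < e"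
    if \<phi>: "\<phi> \<in> DLp 1" and "0 < e" for \<phi> e
  proof (intro exI[of _ "e / (\<bar>C\<bar> + 1)"] conjI ballI impI)
    fix \<psi> assume \<psi>: "\<psi> \<in> DLp 1" and *: "DLp_norm k 1 (\<lambda>x. \<psi> x - \<phi> x) < e / (\<bar>C\<bar> + 1)"
    have "T \<psi> - T \<phi> = T (\<lambda>x. \<psi> x - \<phi> x)"
      using assms(2)[OF \<psi> DLp_1_cmult[OF \<phi>, of "- 1"]] cmult[OF \<phi>, of "- 1"] by simp
    then have "norm (T \<psi> - T \<phi>) \<le> C * DLp_norm k 1 (\<lambda>x. \<psi> x - \<phi> x)"
      using bound[OF DLp_1_diff[OF \<psi> \<phi>]] by simp
    also have "\<dots> \<le> (\<bar>C\<bar> + 1) * DLp_norm k 1 (\<lambda>x. \<psi> x - \<phi> x)"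
      by (intro mult_right_mono DLp_norm_1_nonneg) auto
    also have "\<dots> < e" using * by (simp add: field_simps)
    finally show "norm (T \<psi> - T \<phi>) < e" .
  qed (use \<open>0 < e\<close> in auto)
  then show ?thesis
    unfolding bounded_distributions_def using assms(1,2) cmult
    by (intro CollectI conjI ballI allI impI exI[of _ k]) auto
qed

text \<open>A remainder estimate passes through a bounded functional or an integral, which the bare
  existence of a derivative does not. Both \<open>dist_conv\<close> and integrals with a parameter
  are differentiated in this way.\<close>

lemma has_vector_derivative_quadratic_bound:
  fixes f :: "real \<Rightarrow> complex"
  assumes "\<And>h. \<bar>h\<bar> \<le> 1 \<Longrightarrow> norm (f (x + h) - f x - of_real h * d) \<le> K * h\<^sup>2"
  shows "(f has_vector_derivative d) (at x)"
  unfolding has_vector_derivative_def has_derivative_at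
proof
  show "bounded_linear (\<lambda>h. h *\<^sub>R d)" by (rule bounded_linear_scaleR_left)
  show "(\<lambda>h. norm (f (x + h) - f x - h *\<^sub>R d) / norm h) \<midarrow>0\<rightarrow> 0"
  proof (rule tendsto_sandwich[where f="\<lambda>_. 0" and h="\<lambda>h. K * \<bar>h\<bar>"])
    have "\<forall>\<^sub>F h::real in at 0. \<bar>h\<bar> \<le> 1 \<and> h \<noteq> 0"
      unfolding eventually_at by (intro exI[of _ 1]) auto
    then show "\<forall>\<^sub>F h in at 0. norm (f (x + h) - f x - h *\<^sub>R d) / norm h \<le> K * \<bar>h\<bar>"
    proof eventually_elim
      case (elim h)
      then show ?case
        using assms[of h] by (simp add: pos_divide_le_eq power2_eq_square scaleR_conv_of_real mult.assoc)
    qed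
    show "((\<lambda>h. K * \<bar>h\<bar>) \<longlongrightarrow> 0) (at 0)"
      by (auto intro!: tendsto_eq_intros)
  qed auto
qed

text \<open>By linearity the remainder of the convolution at \<open>x\<close> is \<open>T\<close>
  applied to the Taylor remainder of \<open>\<psi>\<close> at \<open>x - y\<close>, whose norm in
  \<open>DLp 1\<close> is of order \<open>h\<^sup>2\<close>.\<close>

lemma dist_conv_has_vector_derivative:
  assumes T: "T \<in> bounded_distributions" and \<psi>: "\<psi> \<in> decaying"
  shows "(dist_conv T \<psi> has_vector_derivative dist_conv T (nderiv 1 \<psi>) x) (at x)"
proof -
  obtain k C where C: "0 \<le> C" "\<And>\<phi>. \<phi> \<in> DLp 1 \<Longrightarrow> norm (T \<phi>) \<le> C * DLp_norm k 1 \<phi>"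
    by (rule bounded_distribution_bound[OF T]) (rule that)
  \<comment> \<open>The norm has order \<open>k\<close>, and the Taylor remainder costs two
    derivatives more.\<close>
  obtain B where B: "0 \<le> B" "\<And>j y. j \<le> k + 2 \<Longrightarrow> norm (nderiv j \<psi> y) \<le> B / (1 + y\<^sup>2)"
    by (rule decaying_bound[OF \<psi>]) (rule that)
  have s: "smooth \<psi>" using \<psi> by (rule decaying_smooth)
  have D: "\<psi> \<in> DLp 1" "nderiv 1 \<psi> \<in> DLp 1"
    using \<psi> by (auto intro: decaying_DLp_1 decaying_nderiv)
  show ?thesis
  proof (rule has_vector_derivative_quadratic_bound)
    fix h :: real assume h: "\<bar>h\<bar> \<le> 1"
    let ?g = "\<lambda>y. \<psi> (x + h - y) - \<psi> (x - y) - of_real h * nderiv 1 \<psi> (x - y)"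
    have g: "?g \<in> DLp 1"
      by (intro DLp_1_diff DLp_1_reflect DLp_1_cmult D)
    have "DLp_norm k 1 ?g \<le> real (Suc k) * ((4 * B * h\<^sup>2) * pi)"
    proof (rule DLp_norm_1_weight_bound[where x=x])
      show "smooth ?g" using g by (rule DLp_1_smooth)
      fix j y assume j: "j \<le> k"
      have "nderiv j ?g y = (- 1) ^ j * nderiv j \<psi> (x + h - y) - (- 1) ^ j * nderiv j \<psi> (x - y)
          - of_real h * ((- 1) ^ j * nderiv (Suc j) \<psi> (x - y))"
        by (simp add: nderiv_diff nderiv_cmult nderiv_reflect smooth_reflect smooth_cmult smooth_diff
            smooth_nderiv s nderiv_nderiv)
      also have "\<dots> = (- 1) ^ j * (nderiv j \<psi> (x + h - y) - nderiv j \<psi> (x - y)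
          - of_real h * nderiv (Suc j) \<psi> (x - y))"
        by (simp add: algebra_simps)
      finally have "nderiv j ?g y = \<dots>" .
      then have "norm (nderiv j ?g y) = norm (nderiv j \<psi> (x + h - y) - nderiv j \<psi> (x - y)
          - of_real ((x + h - y) - (x - y)) * nderiv (Suc j) \<psi> (x - y))"
        by (simp add: norm_mult norm_power)
      also have "\<dots> \<le> (4 * B / (1 + (x - y)\<^sup>2)) * ((x + h - y) - (x - y))\<^sup>2"
      proof (rule nderiv_taylor_bound[OF s])
        fix t assume "t \<in> closed_segment (x - y) (x + h - y)"
        then have "\<bar>t - (x - y)\<bar> \<le> 1"
          using h by (auto simp: closed_segment_eq_real_ivl split: if_splits)
        then have "(t - (x - y))\<^sup>2 \<le> 1" using power2_le_iff_abs_le[of 1 "t - (x - y)"] by simp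
        have "norm (nderiv (Suc (Suc j)) \<psi> t) \<le> B / (1 + ((x - y) + (t - (x - y)))\<^sup>2)"
          using B(2)[of "Suc (Suc j)" t] j by simp
        also have "\<dots> \<le> 2 * (1 + (t - (x - y))\<^sup>2) * B / (1 + (x - y)\<^sup>2)"
          by (rule weight_shift[OF B(1)])
        \<comment> \<open>The shift of the weight is at most \<open>\<bar>h\<bar> \<le> 1\<close>;
          this is the origin of the factor 4.\<close>
        also have "\<dots> \<le> 2 * (1 + 1) * B / (1 + (x - y)\<^sup>2)"
          using \<open>(t - (x - y))\<^sup>2 \<le> 1\<close> B(1)
          by (intro divide_right_mono mult_right_mono mult_left_mono) auto
        finally show "norm (nderiv (Suc (Suc j)) \<psi> t) \<le> 4 * B / (1 + (x - y)\<^sup>2)" by simp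
      qed
      finally show "norm (nderiv j ?g y) \<le> 4 * B * h\<^sup>2 / (1 + (x - y)\<^sup>2)" by simp
    qed
    then have "norm (T ?g) \<le> C * (real (Suc k) * ((4 * B * h\<^sup>2) * pi))"
      using C(2)[OF g] mult_left_mono[OF _ C(1)] by (meson order_trans)
    moreover have "T ?g = dist_conv T \<psi> (x + h) - dist_conv T \<psi> x - of_real h * dist_conv T (nderiv 1 \<psi>) x"
    proof -
      have *: "(\<lambda>y. \<psi> (x + h - y)) \<in> DLp 1" "(\<lambda>y. \<psi> (x - y)) \<in> DLp 1"
        "(\<lambda>y. nderiv 1 \<psi> (x - y)) \<in> DLp 1"
        by (intro DLp_1_reflect D)+
      show ?thesis
        unfolding dist_conv_def
          dist_minus[OF T DLp_1_diff[OF *(1,2)] DLp_1_cmult[OF *(3)]]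
          dist_minus[OF T *(1,2)] dist_cmult[OF T *(3)] ..
    qed
    ultimately show "norm (dist_conv T \<psi> (x + h) - dist_conv T \<psi> x - of_real h * dist_conv T (nderiv 1 \<psi>) x)
        \<le> (C * real (Suc k) * 4 * B * pi) * h\<^sup>2"
      by (simp only: mult_ac)
  qed
qed

lemma
  assumes T: "T \<in> bounded_distributions" and \<psi>: "\<psi> \<in> decaying"
  shows nderiv_dist_conv: "nderiv j (dist_conv T \<psi>) = dist_conv T (nderiv j \<psi>)"
    and smooth_dist_conv: "smooth (dist_conv T \<psi>)"
proof -
  have *: "(dist_conv T (nderiv j \<psi>) has_vector_derivative dist_conv T (nderiv (Suc j) \<psi>) x) (at x)" for j x
    using dist_conv_has_vector_derivative[OF T decaying_nderiv[OF \<psi>]] by (simp add: nderiv_nderiv)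
  show "nderiv j (dist_conv T \<psi>) = dist_conv T (nderiv j \<psi>)"
    by (rule nderiv_sequence[where F="\<lambda>j. dist_conv T (nderiv j \<psi>)", OF _ *]) simp
  show "smooth (dist_conv T \<psi>)"
    by (rule smooth_sequence[where F="\<lambda>j. dist_conv T (nderiv j \<psi>)", OF _ *]) simp
qed

section \<open>Almost periodic functions\<close>

lemma uniform_limit_subseq:
  "uniform_limit X f l sequentially \<Longrightarrow> strict_mono r \<Longrightarrow> uniform_limit X (\<lambda>k. f (r k)) l sequentially"
  using filterlim_compose filterlim_subseq by blast

lemma C_ap_continuous: "f \<in> C_ap \<Longrightarrow> continuous_on UNIV f"
  by (simp add: C_ap_def)

lemma C_ap_subseq:
  assumes "f \<in> C_ap"
  obtains r g where "strict_mono (r :: nat \<Rightarrow> nat)"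
    "uniform_limit UNIV (\<lambda>k x. f (x + h (r k))) g sequentially"
  using assms unfolding C_ap_def by blast

lemma C_apI:
  assumes "continuous_on UNIV f"
    and "\<And>h. \<exists>r g. strict_mono (r :: nat \<Rightarrow> nat) \<and> uniform_limit UNIV (\<lambda>k x. f (x + h (r k))) g sequentially"
  shows "f \<in> C_ap"
  using assms unfolding C_ap_def by blast

lemma C_ap_add:
  assumes "f \<in> C_ap" "g \<in> C_ap" shows "(\<lambda>x. f x + g x) \<in> C_ap"
proof (rule C_apI)
  fix h :: "nat \<Rightarrow> real"
  obtain r f' where r: "strict_mono (r :: nat \<Rightarrow> nat)"
    "uniform_limit UNIV (\<lambda>k x. f (x + h (r k))) f' sequentially"
    using C_ap_subseq[OF assms(1)] .
  obtain s g' where s: "strict_mono (s :: nat \<Rightarrow> nat)"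
    "uniform_limit UNIV (\<lambda>k x. g (x + h (r (s k)))) g' sequentially"
    using C_ap_subseq[OF assms(2), of "\<lambda>k. h (r k)"] .
  show "\<exists>r g'. strict_mono (r :: nat \<Rightarrow> nat) \<and>
      uniform_limit UNIV (\<lambda>k x. f (x + h (r k)) + g (x + h (r k))) g' sequentially"
    by (intro exI conjI, rule strict_mono_o[OF r(1) s(1)], unfold o_def, rule uniform_limit_add)
      (rule uniform_limit_subseq[OF r(2) s(1)] s(2))+
qed (intro continuous_intros C_ap_continuous assms)

lemma C_ap_cmult:
  assumes "f \<in> C_ap" shows "(\<lambda>x. c * f x) \<in> C_ap"
proof (rule C_apI)
  fix h :: "nat \<Rightarrow> real"
  obtain r g where r: "strict_mono (r :: nat \<Rightarrow> nat)"
    "uniform_limit UNIV (\<lambda>k x. f (x + h (r k))) g sequentially"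
    using C_ap_subseq[OF assms(1)] .
  show "\<exists>r g. strict_mono (r :: nat \<Rightarrow> nat) \<and>
      uniform_limit UNIV (\<lambda>k x. c * f (x + h (r k))) g sequentially"
    using r(1) bounded_linear.uniform_limit[OF bounded_linear_mult_right r(2), of c] by blast
qed (intro continuous_intros C_ap_continuous assms)

text \<open>If \<open>f\<close> were unbounded, translating by points \<open>h n\<close> with
  \<open>real n < norm (f (h n))\<close> and evaluating at 0 would give a convergent yet unbounded
  sequence.\<close>

lemma C_ap_bounded:
  assumes "f \<in> C_ap"
  obtains M where "\<And>x. norm (f x) \<le> M"
proof -
  have "\<exists>M. \<forall>x. norm (f x) \<le> M"
  proof (rule ccontr)
    assume "\<not> ?thesis"
    then have "\<forall>n::nat. \<exists>x. real n < norm (f x)" by (meson not_le)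
    then obtain h where h: "real n < norm (f (h n))" for n :: nat
      by metis
    obtain r g where r: "strict_mono (r :: nat \<Rightarrow> nat)"
      "uniform_limit UNIV (\<lambda>k x. f (x + h (r k))) g sequentially"
      using C_ap_subseq[OF assms(1)] .
    have "(\<lambda>k. f (h (r k))) \<longlonglongrightarrow> g 0"
      using tendsto_uniform_limitI[OF r(2), of 0] by simp
    then have "Bseq (\<lambda>k. f (h (r k)))"
      by (intro convergent_imp_Bseq convergentI)
    then obtain K where K: "\<And>k. norm (f (h (r k))) \<le> K" by (auto simp: Bseq_def)
    obtain n where "K < real n" using reals_Archimedean2 by blast
    also have "real n \<le> real (r n)" using seq_suble[OF r(1)] by simp
    also have "\<dots> < norm (f (h (r n)))" by (rule h)
    finally show False using K[of n] by simp
  qed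
  then show thesis using that by blast
qed

text \<open>A Cantor diagonal sequence makes the translates of all approximants \<open>g n\<close>
  converge simultaneously. Splitting the error into three parts then shows that the translates of
  \<open>f\<close> are uniformly Cauchy.\<close>

lemma C_ap_uniform_closed:
  assumes cont: "continuous_on UNIV f"
    and approx: "\<And>e. 0 < e \<Longrightarrow> \<exists>g\<in>C_ap. \<forall>x. dist (f x) (g x) < e"
  shows "f \<in> C_ap"
proof (rule C_apI[OF cont])
  fix h :: "nat \<Rightarrow> real"
  have "\<forall>n. \<exists>g. g \<in> C_ap \<and> (\<forall>x. dist (f x) (g x) < 1 / real (Suc n))"
    using approx by (metis zero_less_divide_1_iff of_nat_0_less_iff zero_less_Suc)
  then obtain g where g: "g n \<in> C_ap" "dist (f x) (g n x) < 1 / real (Suc n)" for n x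
    by metis
  define P where "P n s \<longleftrightarrow> (\<exists>l. uniform_limit UNIV (\<lambda>k x. g n (x + h (s k))) l sequentially)"
    for n and s :: "nat \<Rightarrow> nat"
  interpret subseqs P
  proof
    fix n and s :: "nat \<Rightarrow> nat" assume "strict_mono s"
    show "\<exists>r'. strict_mono r' \<and> P n (s \<circ> r')"
      using C_ap_subseq[OF g(1)[of n], of "\<lambda>k. h (s k)"] unfolding P_def o_def by metis
  qed
  \<comment> \<open>Only the tail of the diagonal sequence after index \<open>n\<close> is a
    subsequence of the one chosen for \<open>g n\<close>, hence the offset \<open>Suc n\<close>,
    which is subtracted again below.\<close>
  have P: "P n (diagseq \<circ> ((+) (Suc n)))" for n
  proof (rule diagseq_holds)
    fix r s :: "nat \<Rightarrow> nat" and n assume r: "strict_mono r" and "P n s"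
    then obtain l where "uniform_limit UNIV (\<lambda>k x. g n (x + h (s k))) l sequentially"
      unfolding P_def by blast
    from uniform_limit_subseq[OF this r] show "P n (s \<circ> r)"
      unfolding P_def o_def by blast
  qed
  have "uniformly_Cauchy_on UNIV (\<lambda>k x. f (x + h (diagseq k)))"
  proof (rule uniformly_Cauchy_onI)
    fix e :: real assume e: "0 < e"
    obtain n where n: "1 / real (Suc n) < e / 3"
      using reals_Archimedean[of "e / 3"] e by (auto simp: inverse_eq_divide)
    have fg: "dist (f x) (g n x) < e / 3" for x
      using g(2)[of x n] n by simp
    have "uniformly_convergent_on UNIV (\<lambda>k x. g n (x + h (diagseq (Suc n + k))))"
      using P[of n] unfolding P_def o_def by (rule exE) (rule uniformly_convergentI)
    then have "uniformly_Cauchy_on UNIV (\<lambda>k x. g n (x + h (diagseq (Suc n + k))))"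
      by (rule uniformly_convergent_Cauchy)
    then obtain M where M: "\<And>x i j. M \<le> i \<Longrightarrow> M \<le> j \<Longrightarrow>
        dist (g n (x + h (diagseq (Suc n + i)))) (g n (x + h (diagseq (Suc n + j)))) < e / 3"
      unfolding uniformly_Cauchy_on_def using e by (metis UNIV_I zero_less_divide_iff zero_less_numeral)
    have "dist (f (x + h (diagseq i))) (f (x + h (diagseq j))) < e"
      if ij: "Suc n + M \<le> i" "Suc n + M \<le> j" for x i j
    proof -
      have "dist (g n (x + h (diagseq i))) (g n (x + h (diagseq j))) < e / 3"
        using M[of "i - Suc n" "j - Suc n" x] ij by simp
      with fg[of "x + h (diagseq i)"] fg[of "x + h (diagseq j)"] show ?thesis by metric
    qed
    then show "\<exists>M. \<forall>x\<in>UNIV. \<forall>i\<ge>M. \<forall>j\<ge>M. dist (f (x + h (diagseq i))) (f (x + h (diagseq j))) < e"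
      by blast
  qed
  then have "uniformly_convergent_on UNIV (\<lambda>k x. f (x + h (diagseq k)))"
    by (rule Cauchy_uniformly_convergent)
  then show "\<exists>r g. strict_mono (r :: nat \<Rightarrow> nat) \<and>
      uniform_limit UNIV (\<lambda>k x. f (x + h (r k))) g sequentially"
    using subseq_diagseq unfolding uniformly_convergent_on_def by blast
qed

section \<open>Supremum norms and the space \<open>B_ap\<close>\<close>

lemma
  assumes "continuous_on UNIV f" "\<And>x. norm (f x) \<le> B"
  shows Lp_norm_infinity_le: "Lp_norm \<infinity> f \<le> B"
    and Lp_space_infinityI: "f \<in> Lp_space \<infinity>"
proof -
  have f: "f \<in> borel_measurable lborel"
    using assms(1) by (simp add: borel_measurable_continuous_onI)
  \<comment> \<open>Covers the case of an essential supremum \<open>- \<infinity>\<close>, which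
    \<open>real_of_ereal\<close> sends to 0.\<close>
  have "0 \<le> B" using norm_ge_zero assms(2) by (rule order_trans)
  have "esssup lborel (\<lambda>x. ereal (norm (f x))) \<le> ereal B"
    using f assms(2) by (intro esssup_I) auto
  then show "Lp_norm \<infinity> f \<le> B" "f \<in> Lp_space \<infinity>"
    using f \<open>0 \<le> B\<close> by (cases "esssup lborel (\<lambda>x. ereal (norm (f x)))";
        force simp: Lp_norm_def Lp_space_def)+
qed

text \<open>A closed set of full Lebesgue measure is the whole line, so for continuous functions an
  almost everywhere bound holds everywhere. From here on supremum norms are handled
  pointwise.\<close>

lemma norm_le_Lp_norm_infinity:
  assumes "continuous_on UNIV f" "f \<in> Lp_space \<infinity>"
  shows "norm (f x) \<le> Lp_norm \<infinity> f"
proof -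
  let ?E = "esssup lborel (\<lambda>x. ereal (norm (f x)))"
  have AE: "AE x in lborel. ereal (norm (f x)) \<le> ?E" by (rule esssup_AE)
  have "?E \<noteq> \<infinity>" using assms(2) by (auto simp: Lp_space_def)
  moreover have "?E \<noteq> - \<infinity>"
  proof
    assume "?E = - \<infinity>"
    with AE have "AE x::real in lborel. False" by simp
    then show False by (simp add: trivial_limit_def[symmetric] ae_filter_eq_bot_iff)
  qed
  ultimately obtain r where r: "?E = ereal r" by (cases ?E) auto
  have "AE x in lebesgue. x \<in> {x. norm (f x) \<le> r}"
    using AE unfolding r by (intro AE_completion) simp
  moreover have "closed {x. norm (f x) \<le> r}"
    by (intro closed_Collect_le continuous_intros assms)
  ultimately have "x \<in> {x. norm (f x) \<le> r}"
    by (rule mem_closed_if_AE_lebesgue[rotated])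
  then show ?thesis by (simp add: Lp_norm_def r)
qed

text \<open>By \<open>C_ap_bounded\<close>, the essential bounds in \<open>DLp \<infinity>\<close>
  come with the almost periodicity of the derivatives.\<close>

lemma B_ap_iff: "\<phi> \<in> B_ap \<longleftrightarrow> smooth \<phi> \<and> (\<forall>j. nderiv j \<phi> \<in> C_ap)"
proof -
  have "f \<in> Lp_space \<infinity>" if f: "f \<in> C_ap" for f
    using C_ap_bounded[OF f] Lp_space_infinityI[OF C_ap_continuous[OF f]] by metis
  then show ?thesis by (auto simp: B_ap_def DLp_def)
qed

lemma B_ap_norm_bound:
  assumes "\<phi> \<in> B_ap" shows "norm (nderiv j \<phi> x) \<le> Lp_norm \<infinity> (nderiv j \<phi>)"
  using assms by (intro norm_le_Lp_norm_infinity) (auto simp: B_ap_def DLp_def C_ap_continuous)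

lemma B_ap_Lp_norm_le:
  assumes "\<phi> \<in> B_ap" "\<And>x. norm (nderiv j \<phi> x) \<le> B" shows "Lp_norm \<infinity> (nderiv j \<phi>) \<le> B"
  using assms by (intro Lp_norm_infinity_le) (auto simp: B_ap_def C_ap_continuous)

lemma B_ap_Lp_norm_nonneg: "\<phi> \<in> B_ap \<Longrightarrow> 0 \<le> Lp_norm \<infinity> (nderiv j \<phi>)"
  using B_ap_norm_bound[of \<phi> j 0] norm_ge_zero order_trans by blast

lemma B_ap_DLp_norm_nonneg: "\<phi> \<in> B_ap \<Longrightarrow> 0 \<le> DLp_norm k \<infinity> \<phi>"
  by (simp add: DLp_norm_def sum_nonneg B_ap_Lp_norm_nonneg)

lemma B_ap_add: "\<phi> \<in> B_ap \<Longrightarrow> \<psi> \<in> B_ap \<Longrightarrow> (\<lambda>x. \<phi> x + \<psi> x) \<in> B_ap"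
  by (simp add: B_ap_iff nderiv_add smooth_add C_ap_add)

lemma B_ap_cmult: "\<phi> \<in> B_ap \<Longrightarrow> (\<lambda>x. c * \<phi> x) \<in> B_ap"
  by (simp add: B_ap_iff nderiv_cmult smooth_cmult C_ap_cmult)

lemma B_ap_nderiv: "\<phi> \<in> B_ap \<Longrightarrow> nderiv j \<phi> \<in> B_ap"
  by (simp add: B_ap_iff nderiv_nderiv smooth_nderiv)

lemma B_ap_smooth: "\<phi> \<in> B_ap \<Longrightarrow> smooth \<phi>"
  by (simp add: B_ap_iff)

lemma B_ap_zero: "(\<lambda>x. 0) \<in> B_ap"
proof -
  have "(\<lambda>x. 0) \<in> C_ap"
    by (rule C_apI) (auto intro: strict_mono_id uniform_limit_const)
  then show ?thesis by (simp add: B_ap_iff smooth_zero nderiv_zero)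
qed

lemma DLp_norm_infinity_add:
  assumes "\<phi> \<in> B_ap" "\<psi> \<in> B_ap"
  shows "DLp_norm k \<infinity> (\<lambda>x. \<phi> x + \<psi> x) \<le> DLp_norm k \<infinity> \<phi> + DLp_norm k \<infinity> \<psi>"
  unfolding DLp_norm_def sum.distrib[symmetric]
proof (intro sum_mono B_ap_Lp_norm_le B_ap_add assms)
  fix j x
  have "norm (nderiv j (\<lambda>x. \<phi> x + \<psi> x) x) \<le> norm (nderiv j \<phi> x) + norm (nderiv j \<psi> x)"
    by (simp add: nderiv_add B_ap_smooth assms norm_triangle_ineq)
  then show "norm (nderiv j (\<lambda>x. \<phi> x + \<psi> x) x) \<le> Lp_norm \<infinity> (nderiv j \<phi>) + Lp_norm \<infinity> (nderiv j \<psi>)"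
    using B_ap_norm_bound[OF assms(1), of j x] B_ap_norm_bound[OF assms(2), of j x] by linarith
qed

lemma DLp_norm_infinity_cmult:
  assumes "\<phi> \<in> B_ap"
  shows "DLp_norm k \<infinity> (\<lambda>x. c * \<phi> x) \<le> norm c * DLp_norm k \<infinity> \<phi>"
  unfolding DLp_norm_def sum_distrib_left
  by (intro sum_mono B_ap_Lp_norm_le B_ap_cmult assms)
    (simp add: nderiv_cmult B_ap_smooth assms norm_mult mult_left_mono B_ap_norm_bound)

lemma DLp_norm_infinity_nderiv:
  assumes "\<phi> \<in> B_ap"
  shows "DLp_norm k \<infinity> (nderiv j \<phi>) \<le> DLp_norm (k + j) \<infinity> \<phi>"
proof -
  have "DLp_norm k \<infinity> (nderiv j \<phi>) = (\<Sum>i\<in>(\<lambda>i. i + j) ` {..k}. Lp_norm \<infinity> (nderiv i \<phi>))"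
    by (simp add: DLp_norm_def nderiv_nderiv sum.reindex)
  also have "\<dots> \<le> DLp_norm (k + j) \<infinity> \<phi>"
    unfolding DLp_norm_def by (intro sum_mono2) (auto simp: B_ap_Lp_norm_nonneg assms)
  finally show ?thesis .
qed

section \<open>Nets and their classes\<close>

lemma eventually_at_right_0_Ioc: "\<forall>\<^sub>F \<epsilon>::real in at_right 0. \<epsilon> \<in> {0<..1}"
  unfolding eventually_at_right_field by (intro exI[of _ 1]) auto

lemma
  assumes "u \<in> N_ap"
  shows N_ap_B_ap: "\<epsilon> \<in> {0<..1} \<Longrightarrow> u \<epsilon> \<in> B_ap"
    and N_ap_bigo: "(\<lambda>\<epsilon>. DLp_norm k \<infinity> (u \<epsilon>)) \<in> O[at_right 0](\<lambda>\<epsilon>. \<epsilon> ^ m)"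
  using assms by (auto simp: N_ap_def)

text \<open>It suffices to majorise each norm by a negligible function \<open>b k\<close>. The norms
  are nonnegative on \<open>B_ap\<close>, so the majorisation passes to the absolute values in the
  Landau relation.\<close>

lemma N_apI:
  assumes "u \<in> extensional {0<..1}" "\<And>\<epsilon>. \<epsilon> \<in> {0<..1} \<Longrightarrow> u \<epsilon> \<in> B_ap"
    and "\<And>\<epsilon> k. \<epsilon> \<in> {0<..1} \<Longrightarrow> DLp_norm k \<infinity> (u \<epsilon>) \<le> b k \<epsilon>"
    and "\<And>k m. b k \<in> O[at_right 0](\<lambda>\<epsilon>. \<epsilon> ^ m)"
  shows "u \<in> N_ap"
proof -
  have "(\<lambda>\<epsilon>. DLp_norm k \<infinity> (u \<epsilon>)) \<in> O[at_right 0](\<lambda>\<epsilon>. \<epsilon> ^ m)" for k m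
  proof (rule landau_o.big_trans[OF landau_o.big_mono assms(4)[of k m]])
    show "\<forall>\<^sub>F \<epsilon> in at_right 0. norm (DLp_norm k \<infinity> (u \<epsilon>)) \<le> norm (b k \<epsilon>)"
      using eventually_at_right_0_Ioc
    proof eventually_elim
      case (elim \<epsilon>)
      then show ?case
        using assms(3)[OF elim, of k] B_ap_DLp_norm_nonneg[OF assms(2)[OF elim], of k] by simp
    qed
  qed
  then show ?thesis using assms(1,2) by (auto simp: N_ap_def PiE_def)
qed

lemma N_ap_zero: "(\<lambda>\<epsilon>\<in>{0<..1}. \<lambda>x. 0) \<in> N_ap"
proof (rule N_apI[where b="\<lambda>_ _. 0"])
  fix \<epsilon> :: real and k assume "\<epsilon> \<in> {0<..1}"
  then show "DLp_norm k \<infinity> ((\<lambda>\<epsilon>\<in>{0<..1}. \<lambda>x. 0) \<epsilon>) \<le> 0"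
    by (simp add: DLp_norm_def nderiv_zero) (intro mult_nonneg_nonpos Lp_norm_infinity_le, auto)
qed (auto simp: B_ap_zero)

lemma N_ap_add:
  assumes "u \<in> N_ap" "v \<in> N_ap" shows "net_add u v \<in> N_ap"
  by (rule N_apI[where b="\<lambda>k \<epsilon>. DLp_norm k \<infinity> (u \<epsilon>) + DLp_norm k \<infinity> (v \<epsilon>)"])
    (auto simp: net_add_def intro!: B_ap_add DLp_norm_infinity_add sum_in_bigo N_ap_bigo
      N_ap_B_ap[OF assms(1)] N_ap_B_ap[OF assms(2)] assms)

lemma N_ap_scale:
  assumes "u \<in> N_ap" shows "net_scale c u \<in> N_ap"
  by (rule N_apI[where b="\<lambda>k \<epsilon>. norm c * DLp_norm k \<infinity> (u \<epsilon>)"])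
    (auto simp: net_scale_def N_ap_bigo assms
      intro!: B_ap_cmult DLp_norm_infinity_cmult N_ap_B_ap[OF assms])

lemma N_ap_deriv:
  assumes "u \<in> N_ap" shows "net_deriv j u \<in> N_ap"
  by (rule N_apI[where b="\<lambda>k \<epsilon>. DLp_norm (k + j) \<infinity> (u \<epsilon>)"])
    (auto simp: net_deriv_def intro!: B_ap_nderiv DLp_norm_infinity_nderiv N_ap_bigo
      N_ap_B_ap[OF assms] assms)

lemma net_add_assoc: "net_add (net_add u v) w = net_add u (net_add v w)"
  by (auto simp: net_add_def add.assoc restrict_def)

lemma net_add_commute: "net_add u v = net_add v u"
  by (auto simp: net_add_def add.commute restrict_def)

text \<open>\<open>net_add\<close> returns \<open>undefined\<close> off \<open>{0<..1}\<close>, so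
  adding the zero net gives back \<open>u\<close> only if \<open>u\<close> is extensional.\<close>

lemma net_class_self:
  assumes "u \<in> extensional {0<..1}" shows "u \<in> net_class u"
proof -
  have "u = net_add u (\<lambda>\<epsilon>\<in>{0<..1}. \<lambda>x. 0)"
    by (rule extensionalityI[OF assms]) (auto simp: net_add_def)
  then show ?thesis using N_ap_zero unfolding net_class_def by blast
qed

lemma net_class_add:
  assumes "n \<in> N_ap" shows "net_class (net_add u n) = net_class u"
proof
  show "net_class (net_add u n) \<subseteq> net_class u"
    using N_ap_add[OF assms] by (auto simp: net_class_def net_add_assoc)
  have "net_add u m = net_add (net_add u n) (net_add (net_scale (- 1) n) m)" for m
    by (auto simp: net_add_def net_scale_def restrict_def)
  then show "net_class u \<subseteq> net_class (net_add u n)"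
    using N_ap_add[OF N_ap_scale[OF assms]] unfolding net_class_def by blast
qed

text \<open>Other representatives alter the sum by an element of \<open>N_ap\<close>, so the union
  repeats a single coset; \<open>N_ap_zero\<close> ensures that the union is not empty. The next two
  lemmas follow the same pattern.\<close>

lemma G_add_net_class: "G_add (net_class u) (net_class v) = net_class (net_add u v)"
proof -
  have "net_class (net_add (net_add u m) (net_add v n)) = net_class (net_add u v)"
    if "m \<in> N_ap" "n \<in> N_ap" for m n
  proof -
    have "net_add (net_add u m) (net_add v n) = net_add (net_add u v) (net_add m n)"
      by (metis net_add_assoc net_add_commute)
    then show ?thesis using net_class_add N_ap_add that by simp
  qed
  then show ?thesis
    using N_ap_zero unfolding G_add_def by (auto simp: net_class_def[of u] net_class_def[of v])
qed

lemma G_scale_net_class: "G_scale c (net_class u) = net_class (net_scale c u)"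
proof -
  have "net_class (net_scale c (net_add u n)) = net_class (net_scale c u)" if "n \<in> N_ap" for n
  proof -
    have "net_scale c (net_add u n) = net_add (net_scale c u) (net_scale c n)"
      by (auto simp: net_scale_def net_add_def restrict_def algebra_simps)
    then show ?thesis using net_class_add N_ap_scale that by simp
  qed
  then show ?thesis
    using N_ap_zero unfolding G_scale_def by (auto simp: net_class_def[of u])
qed

lemma G_deriv_net_class:
  assumes "\<And>\<epsilon>. \<epsilon> \<in> {0<..1} \<Longrightarrow> u \<epsilon> \<in> B_ap"
  shows "G_deriv j (net_class u) = net_class (net_deriv j u)"
proof -
  have "net_class (net_deriv j (net_add u n)) = net_class (net_deriv j u)" if n: "n \<in> N_ap" for n
  proof -
    \<comment> \<open>\<open>nderiv\<close> is additive on smooth functions, and the assumption on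
      \<open>u\<close> provides the smoothness.\<close>
    have "net_deriv j (net_add u n) = net_add (net_deriv j u) (net_deriv j n)"
      unfolding net_deriv_def net_add_def
      by (rule restrict_ext) (simp add: nderiv_add B_ap_smooth assms N_ap_B_ap[OF n])
    then show ?thesis using net_class_add N_ap_deriv n by simp
  qed
  then show ?thesis
    using N_ap_zero unfolding G_deriv_def by (auto simp: net_class_def[of u])
qed

section \<open>Density of the test functions\<close>

text \<open>The functions \<open>p(1 / x) exp(- 1 / x)\<close> with polynomial \<open>p\<close>, extended by \<open>0\<close> to \<open>x \<le> 0\<close>, are closed
  under differentiation and therefore smooth.\<close>

definition flat :: "real poly \<Rightarrow> real \<Rightarrow> real" where
  "flat p x = (if x \<le> 0 then 0 else poly p (1 / x) * exp (- (1 / x)))"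

text \<open>With \<open>t = 1 / x\<close>, the derivative of \<open>p(t) exp(- t)\<close> with
  respect to \<open>x\<close> is \<open>t\<^sup>2 (p(t) - p'(t)) exp(- t)\<close>;
  \<open>[:0, 0, 1:]\<close> is the polynomial \<open>t\<^sup>2\<close>.\<close>

definition flat_deriv :: "real poly \<Rightarrow> real poly" where
  "flat_deriv p = (p - pderiv p) * [:0, 0, 1:]"

text \<open>The power \<open>t ^ n\<close> makes the induction work: since
  \<open>poly (pCons a p) t = a + t * poly p t\<close>, each coefficient raises the exponent by
  one.\<close>

lemma poly_times_exp_minus_tendsto_0: "((\<lambda>t::real. t ^ n * poly p t * exp (- t)) \<longlongrightarrow> 0) at_top"
proof (induction p arbitrary: n rule: pCons_induct)
  case (pCons a p)
  have "((\<lambda>t. a * (t ^ n / exp t) + t ^ Suc n * poly p t * exp (- t)) \<longlongrightarrow> a * 0 + 0) at_top"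
    by (intro tendsto_intros tendsto_power_div_exp_0 pCons.IH)
  then show ?case
    by (simp add: algebra_simps exp_minus divide_inverse)
qed simp

lemma flat_has_derivative: "(flat p has_real_derivative flat (flat_deriv p) x) (at x)"
proof (cases x "0::real" rule: linorder_cases)
  case less
  have "(flat p has_real_derivative 0) (at x)"
    by (rule has_field_derivative_transform_within_open[where f="\<lambda>_. 0" and S="{..<0}"])
      (use less in \<open>auto simp: flat_def\<close>)
  then show ?thesis using less by (simp add: flat_def)
next
  case greater
  have "((\<lambda>x. 1 / x) has_real_derivative - (1 / x\<^sup>2)) (at x)"
    using greater by (auto intro!: derivative_eq_intros simp: power2_eq_square)
  from DERIV_mult[OF DERIV_chain2[OF poly_DERIV[of p] this] DERIV_chain2[OF DERIV_exp DERIV_minus[OF this]]]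
  have "((\<lambda>x. poly p (1 / x) * exp (- (1 / x))) has_real_derivative flat (flat_deriv p) x) (at x)"
    using greater by (simp add: flat_def flat_deriv_def power2_eq_square algebra_simps)
  then show ?thesis
    by (rule has_field_derivative_transform_within_open[where S="{0<..}"])
      (use greater in \<open>auto simp: flat_def\<close>)
next
  case equal
  have "(\<lambda>h. (flat p (0 + h) - flat p 0) / h) \<midarrow>0\<rightarrow> 0"
    unfolding filterlim_split_at
  proof (intro filterlim_split_at)
    have "\<forall>\<^sub>F h::real in at_left 0. h < 0"
      by (simp add: eventually_at_filter)
    then show "((\<lambda>h. (flat p (0 + h) - flat p 0) / h) \<longlongrightarrow> 0) (at_left 0)"
      by (intro tendsto_eventually) (auto elim!: eventually_mono simp: flat_def)
    \<comment> \<open>The right difference quotient at 0, rewritten in \<open>inverse h\<close>; the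
      single power is the division by \<open>h\<close>.\<close>
    have "((\<lambda>h::real. (inverse h) ^ 1 * poly p (inverse h) * exp (- inverse h)) \<longlongrightarrow> 0) (at_right 0)"
      by (rule filterlim_compose[OF poly_times_exp_minus_tendsto_0 filterlim_inverse_at_top_right])
    moreover have "\<forall>\<^sub>F h::real in at_right 0. (inverse h) ^ 1 * poly p (inverse h) * exp (- inverse h)
        = (flat p (0 + h) - flat p 0) / h"
      using eventually_at_right_less[of 0]
      by eventually_elim (simp add: flat_def divide_inverse)
    ultimately show "((\<lambda>h. (flat p (0 + h) - flat p 0) / h) \<longlongrightarrow> 0) (at_right 0)"
      by (rule Lim_transform_eventually)
  qed
  then show ?thesis using equal by (simp add: DERIV_def flat_def)
qed

lemma smooth_flat: "smooth (\<lambda>x. complex_of_real (flat p x))"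
proof (rule smooth_sequence[where F="\<lambda>j x. complex_of_real (flat ((flat_deriv ^^ j) p) x)"])
  show "((\<lambda>x. complex_of_real (flat ((flat_deriv ^^ j) p) x)) has_vector_derivative
      complex_of_real (flat ((flat_deriv ^^ Suc j) p) x)) (at x)" for j x
    using flat_has_derivative[of "(flat_deriv ^^ j) p" x]
    by (auto simp: has_real_derivative_iff_has_vector_derivative
        intro: bounded_linear.has_vector_derivative[OF bounded_linear_of_real])
qed simp

lemma test_function_exists: obtains \<eta> where "\<eta> \<in> test_functions" "\<eta> 0 = 1"
proof
  let ?f = "\<lambda>x. complex_of_real (flat 1 x)"
  \<comment> \<open>The first factor vanishes for \<open>x \<le> - 1\<close> and the second for
    \<open>x \<ge> 1\<close>. Both equal \<open>exp (- 1)\<close> at 0, and \<open>exp 2\<close>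
    normalises their product.\<close>
  let ?\<eta> = "\<lambda>x. of_real (exp 2) * (?f (1 * x + 1) * ?f (- 1 * x + 1))"
  show "?\<eta> \<in> test_functions"
  proof (rule test_functionI)
    show "smooth ?\<eta>" by (intro smooth_cmult smooth_mult smooth_affine smooth_flat)
    show "?\<eta> x = 0" if "1 < \<bar>x\<bar>" for x using that by (auto simp: flat_def)
  qed
  show "?\<eta> 0 = 1"
    by (simp add: flat_def exp_of_real[symmetric] exp_add[symmetric] flip: of_real_mult)
qed

text \<open>The approximants are the cut-offs \<open>\<eta>(x / n) \<phi>(x)\<close>.\<close>

lemma test_functions_dense:
  assumes \<phi>: "\<phi> \<in> DLp 1" and e: "0 < e"
  obtains \<psi> where "\<psi> \<in> test_functions" "DLp_norm k 1 (\<lambda>x. \<psi> x - \<phi> x) < e"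
proof -
  obtain \<eta> where \<eta>: "\<eta> \<in> test_functions" "\<eta> 0 = 1" by (rule test_function_exists)
  have s: "smooth \<phi>" "smooth \<eta>"
    using \<phi> \<eta>(1) by (auto intro: DLp_1_smooth test_function_smooth)
  define c where "c n = inverse (real (Suc n))" for n
  have c: "0 < c n" "c n \<le> 1" for n by (auto simp: c_def divide_simps)
  have c0: "c \<longlonglongrightarrow> 0" unfolding c_def by (rule LIMSEQ_inverse_real_of_nat)
  define \<psi> where "\<psi> n x = \<eta> (c n * x) * \<phi> x" for n x
  have s\<eta>: "smooth (\<lambda>x. \<eta> (c n * x))" for n
    using smooth_affine[OF s(2), of "c n" 0] by simp
  have \<psi>s: "smooth (\<psi> n)" for n
    unfolding \<psi>_def by (intro smooth_mult s\<eta> s)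
  have \<psi>test: "\<psi> n \<in> test_functions" for n
  proof -
    obtain R where R: "\<And>j x. R < \<bar>x\<bar> \<Longrightarrow> nderiv j \<eta> x = 0"
      by (rule test_function_support[OF \<eta>(1)]) (rule that)
    show ?thesis
    proof (rule test_functionI[OF \<psi>s, of "R / c n"])
      fix x assume "R / c n < \<bar>x\<bar>"
      then have "R < \<bar>c n * x\<bar>"
        using c[of n] by (simp add: abs_mult field_simps)
      then show "\<psi> n x = 0" using R[of "c n * x" 0] by (simp add: \<psi>_def)
    qed
  qed
  have nd: "nderiv j (\<psi> n) x = (\<Sum>i\<le>j. of_nat (j choose i) * (of_real (c n ^ i) * nderiv i \<eta> (c n * x))
      * nderiv (j - i) \<phi> x)" for j n x
    unfolding \<psi>_def nderiv_mult[OF s\<eta> s(1)]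
    using nderiv_affine[OF s(2), of _ "c n" 0] by simp
  have "(\<lambda>n. LINT x|lborel. norm (nderiv j (\<psi> n) x - nderiv j \<phi> x)) \<longlonglongrightarrow> (LINT x::real|lborel. 0)" for j
  proof -
    have "\<exists>M. \<forall>x. norm (nderiv i \<eta> x) \<le> M" for i
      using decaying_bounded[OF test_function_decaying[OF \<eta>(1)], of i] by blast
    then obtain M where M: "\<And>i x. norm (nderiv i \<eta> x) \<le> M i" by metis
    \<comment> \<open>A majorant independent of \<open>n\<close>: the powers of \<open>c n\<close>
      are at most 1 and the derivatives of the cut-off are bounded by the
      \<open>M i\<close>.\<close>
    let ?w = "\<lambda>x. (\<Sum>i\<le>j. real (j choose i) * M i * norm (nderiv (j - i) \<phi> x)) + norm (nderiv j \<phi> x)"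
    show ?thesis
    proof (rule integral_dominated_convergence[where w="?w"])
      show "(\<lambda>x. norm (nderiv j (\<psi> n) x - nderiv j \<phi> x)) \<in> borel_measurable lborel" for n
        using smooth_measurable[OF \<psi>s[of n], of j] smooth_measurable[OF s(1), of j] by measurable
      show "integrable lborel ?w"
        using \<phi> by (intro Bochner_Integration.integrable_add Bochner_Integration.integrable_sum
            integrable_mult_right integrable_norm) (auto simp: DLp_1_iff)
      show "AE x in lborel. (\<lambda>n. norm (nderiv j (\<psi> n) x - nderiv j \<phi> x)) \<longlonglongrightarrow> 0"
      proof (rule AE_I2)
        fix x
        have "(\<lambda>n. of_nat (j choose i) * (of_real (c n ^ i) * nderiv i \<eta> (c n * x)) * nderiv (j - i) \<phi> x)
            \<longlonglongrightarrow> of_nat (j choose i) * (of_real (0 ^ i) * nderiv i \<eta> (0 * x)) * nderiv (j - i) \<phi> x" for i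
        proof (intro tendsto_intros c0)
          have "isCont (nderiv i \<eta>) (0 * x)"
            using smooth_continuous_on[OF s(2), of UNIV i] by (simp add: continuous_on_eq_continuous_at)
          then show "(\<lambda>n. nderiv i \<eta> (c n * x)) \<longlonglongrightarrow> nderiv i \<eta> (0 * x)"
            by (rule isCont_tendsto_compose) (intro tendsto_intros c0)
        qed
        then have "(\<lambda>n. nderiv j (\<psi> n) x) \<longlonglongrightarrow>
            (\<Sum>i\<le>j. of_nat (j choose i) * (of_real (0 ^ i) * nderiv i \<eta> (0 * x)) * nderiv (j - i) \<phi> x)"
          unfolding nd by (intro tendsto_sum)
        \<comment> \<open>Every derivative that falls on the cut-off brings a power of
          \<open>c n\<close>, so only \<open>i = 0\<close> survives in the limit.\<close>
        also have "(\<Sum>i\<le>j. of_nat (j choose i) * (of_real (0 ^ i) * nderiv i \<eta> (0 * x)) * nderiv (j - i) \<phi> x)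
            = (\<Sum>i\<in>{0}. of_nat (j choose i) * (of_real (0 ^ i) * nderiv i \<eta> (0 * x)) * nderiv (j - i) \<phi> x)"
          by (intro sum.mono_neutral_right) auto
        also have "\<dots> = nderiv j \<phi> x" using \<eta>(2) by simp
        finally show "(\<lambda>n. norm (nderiv j (\<psi> n) x - nderiv j \<phi> x)) \<longlonglongrightarrow> 0"
          by (intro tendsto_norm_zero LIM_zero)
      qed
      show "AE x in lborel. norm (norm (nderiv j (\<psi> n) x - nderiv j \<phi> x)) \<le> ?w x" for n
      proof (rule AE_I2)
        fix x
        have "norm (nderiv j (\<psi> n) x) \<le> (\<Sum>i\<le>j. real (j choose i) * M i * norm (nderiv (j - i) \<phi> x))"
          unfolding nd
        proof (rule sum_norm_le)
          fix i
          have "norm (of_real (c n ^ i) * nderiv i \<eta> (c n * x)) \<le> 1 * M i"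
            unfolding norm_mult using c[of n]
            by (intro mult_mono M) (auto simp: norm_power power_le_one)
          then show "norm (of_nat (j choose i) * (of_real (c n ^ i) * nderiv i \<eta> (c n * x)) * nderiv (j - i) \<phi> x)
              \<le> real (j choose i) * M i * norm (nderiv (j - i) \<phi> x)"
            unfolding norm_mult[of _ "nderiv (j - i) \<phi> x"] norm_mult[of "of_nat (j choose i)"]
            by (intro mult_right_mono) (auto intro: mult_left_mono)
        qed
        then show "norm (norm (nderiv j (\<psi> n) x - nderiv j \<phi> x)) \<le> ?w x"
          using norm_triangle_ineq4[of "nderiv j (\<psi> n) x" "nderiv j \<phi> x"] by simp
      qed
    qed simp
  qed
  then have "(\<lambda>n. \<Sum>j\<le>k. LINT x|lborel. norm (nderiv j (\<psi> n) x - nderiv j \<phi> x)) \<longlonglongrightarrow> (\<Sum>j\<le>k. 0)"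
    by (intro tendsto_sum) simp
  then have "(\<lambda>n. DLp_norm k 1 (\<lambda>x. \<psi> n x - \<phi> x)) \<longlonglongrightarrow> 0"
    by (simp add: DLp_norm_1 nderiv_diff \<psi>s s)
  then have "\<forall>\<^sub>F n in sequentially. DLp_norm k 1 (\<lambda>x. \<psi> n x - \<phi> x) < e"
    using e by (rule order_tendstoD)
  then obtain n where "DLp_norm k 1 (\<lambda>x. \<psi> n x - \<phi> x) < e"
    by (auto simp: eventually_sequentially)
  then show thesis using that \<psi>test by blast
qed

text \<open>Translation and reflection preserve the norms of \<open>DLp 1\<close>, so one
  approximation of \<open>\<psi>\<close> controls the convolutions at all points \<open>x\<close>
  with the same error.\<close>

lemma ap_distribution_conv_C_ap:
  assumes T: "T \<in> bounded_distributions" "\<And>\<phi>. \<phi> \<in> test_functions \<Longrightarrow> dist_conv T \<phi> \<in> C_ap"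
    and \<psi>: "\<psi> \<in> decaying"
  shows "dist_conv T \<psi> \<in> C_ap"
proof (rule C_ap_uniform_closed)
  show "continuous_on UNIV (dist_conv T \<psi>)"
    using smooth_continuous_on[OF smooth_dist_conv[OF T(1) \<psi>], of UNIV 0] by simp
  fix e :: real assume e: "0 < e"
  obtain k C where C: "0 \<le> C" "\<And>\<phi>. \<phi> \<in> DLp 1 \<Longrightarrow> norm (T \<phi>) \<le> C * DLp_norm k 1 \<phi>"
    by (rule bounded_distribution_bound[OF T(1)]) (rule that)
  have D: "\<psi> \<in> DLp 1" by (rule decaying_DLp_1[OF \<psi>])
  \<comment> \<open>The divisor \<open>C + 1\<close> covers the case \<open>C = 0\<close>; this
    recurs in the later estimates.\<close>
  obtain \<phi> where \<phi>: "\<phi> \<in> test_functions" "DLp_norm k 1 (\<lambda>x. \<phi> x - \<psi> x) < e / (C + 1)"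
    using test_functions_dense[OF D, of "e / (C + 1)" k] e C(1) by auto
  have D': "\<phi> \<in> DLp 1" by (intro decaying_DLp_1 test_function_decaying \<phi>)
  have "dist (dist_conv T \<psi> x) (dist_conv T \<phi> x) < e" for x
  proof -
    have "dist (dist_conv T \<psi> x) (dist_conv T \<phi> x) = norm (T (\<lambda>y. \<phi> (x - y) - \<psi> (x - y)))"
      by (simp add: dist_norm dist_conv_def dist_minus[OF T(1)] DLp_1_reflect D D' norm_minus_commute)
    also have "\<dots> \<le> C * DLp_norm k 1 (\<lambda>y. (\<lambda>y. \<phi> y - \<psi> y) (x - y))"
      by (intro C DLp_1_diff DLp_1_reflect D D')
    also have "\<dots> = C * DLp_norm k 1 (\<lambda>y. \<phi> y - \<psi> y)"
      by (subst DLp_norm_1_reflect) (auto intro: smooth_diff DLp_1_smooth D D')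
    also have "\<dots> \<le> (C + 1) * DLp_norm k 1 (\<lambda>y. \<phi> y - \<psi> y)"
      by (intro mult_right_mono DLp_norm_1_nonneg) simp
    also have "\<dots> < e" using \<phi>(2) C(1) by (simp add: field_simps)
    finally show ?thesis .
  qed
  then show "\<exists>g\<in>C_ap. \<forall>x. dist (dist_conv T \<psi> x) (g x) < e"
    using T(2)[OF \<phi>(1)] by blast
qed

section \<open>Approximation by mollifier translates\<close>

lemma integrable_mult_bounded:
  fixes a b :: "real \<Rightarrow> complex"
  assumes "integrable lborel a" "b \<in> borel_measurable lborel" "\<And>z. norm (b z) \<le> M"
  shows "integrable lborel (\<lambda>z. a z * b z)"
proof (rule Bochner_Integration.integrable_bound)
  show "integrable lborel (\<lambda>z. M * norm (a z))" using assms(1) by simp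
  show "(\<lambda>z. a z * b z) \<in> borel_measurable lborel"
    using borel_measurable_integrable[OF assms(1)] assms(2) by measurable
  have "norm (a z * b z) \<le> norm (M * norm (a z))" for z
    using mult_left_mono[OF assms(3)[of z] norm_ge_zero[of "a z"]]
      abs_ge_self[of "M * norm (a z)"] by (simp add: norm_mult mult.commute)
  then show "AE z in lborel. norm (a z * b z) \<le> norm (M * norm (a z))" by simp
qed

lemma smooth_affine_measurable:
  "smooth b \<Longrightarrow> (\<lambda>z. nderiv j b (c + t * z)) \<in> borel_measurable lborel"
  using smooth_measurable[OF smooth_affine[OF smooth_nderiv, of b j t c], of 0]
  by (simp add: add.commute)

text \<open>The general affine argument covers two forms of the same average: \<open>s = 1\<close>,
  \<open>t = \<epsilon>\<close> for averaging \<open>\<phi>\<close> against \<open>\<rho>\<close>,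
  and \<open>s = - 1\<close>, \<open>t = 1\<close> for averaging the kernel against
  \<open>\<phi>\<close>. Later terms keep factors such as \<open>1 * y\<close> so as to match
  it.\<close>

lemma
  fixes a b :: "real \<Rightarrow> complex" and s t :: real
  assumes a: "integrable lborel a" and b: "smooth b" "\<And>j. \<exists>M. \<forall>x. norm (nderiv j b x) \<le> M"
  shows nderiv_integral: "nderiv j (\<lambda>y. LINT z|lborel. a z * b (s * y + t * z)) =
      (\<lambda>y. of_real (s ^ j) * (LINT z|lborel. a z * nderiv j b (s * y + t * z)))"
    and smooth_integral: "smooth (\<lambda>y. LINT z|lborel. a z * b (s * y + t * z))"
proof -
  let ?G = "\<lambda>j y. of_real (s ^ j) * (LINT z|lborel. a z * nderiv j b (s * y + t * z))"
  obtain M where M: "\<And>j x. norm (nderiv j b x) \<le> M j" using b(2) by metis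
  have m: "(\<lambda>z. nderiv j b (c + t * z)) \<in> borel_measurable lborel" for j c
    by (rule smooth_affine_measurable[OF b(1)])
  have int: "integrable lborel (\<lambda>z. a z * nderiv j b (c + t * z))" for j c
    by (rule integrable_mult_bounded[OF a m M])
  have *: "(?G j has_vector_derivative ?G (Suc j) y) (at y)" for j y
  proof (rule has_vector_derivative_quadratic_bound)
    fix h :: real
    let ?d = "\<lambda>z. nderiv j b (s * (y + h) + t * z) - nderiv j b (s * y + t * z)
        - of_real (s * h) * nderiv (Suc j) b (s * y + t * z)"
    have d: "norm (?d z) \<le> M (Suc (Suc j)) * (s * h)\<^sup>2" for z
      using nderiv_taylor_bound[where a="s * y + t * z" and b="s * (y + h) + t * z" and j=j, OF b(1) M]
      by (simp add: algebra_simps)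
    have eq: "a z * ?d z = a z * nderiv j b (s * (y + h) + t * z) - a z * nderiv j b (s * y + t * z)
        - of_real (s * h) * (a z * nderiv (Suc j) b (s * y + t * z))" for z
      by (simp add: algebra_simps)
    have "integrable lborel (\<lambda>z. a z * ?d z)"
      unfolding eq by (intro Bochner_Integration.integrable_diff integrable_mult_right int)
    moreover have "integrable lborel (\<lambda>z. norm (a z) * (M (Suc (Suc j)) * (s * h)\<^sup>2))"
      using a by simp
    ultimately have "norm (LINT z|lborel. a z * ?d z) \<le> (LINT z|lborel. norm (a z) * (M (Suc (Suc j)) * (s * h)\<^sup>2))"
      by (rule Bochner_Integration.integral_norm_bound_integral)
        (simp only: norm_mult, intro mult_left_mono d norm_ge_zero)
    also have "\<dots> = (LINT z|lborel. norm (a z)) * (M (Suc (Suc j)) * s\<^sup>2) * h\<^sup>2"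
      by (simp add: power_mult_distrib)
    finally have "\<bar>s ^ j\<bar> * norm (LINT z|lborel. a z * ?d z) \<le>
        \<bar>s ^ j\<bar> * ((LINT z|lborel. norm (a z)) * (M (Suc (Suc j)) * s\<^sup>2) * h\<^sup>2)"
      by (rule mult_left_mono) simp
    moreover have "?G j (y + h) - ?G j y - of_real h * ?G (Suc j) y = of_real (s ^ j) * (LINT z|lborel. a z * ?d z)"
    proof -
      have "(LINT z|lborel. a z * ?d z) = (LINT z|lborel. a z * nderiv j b (s * (y + h) + t * z))
          - (LINT z|lborel. a z * nderiv j b (s * y + t * z))
          - of_real (s * h) * (LINT z|lborel. a z * nderiv (Suc j) b (s * y + t * z))"
        unfolding eq by (simp add: int)
      then show ?thesis
        by (simp only: power_Suc of_real_mult right_diff_distrib mult_ac)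
    qed
    ultimately show "norm (?G j (y + h) - ?G j y - of_real h * ?G (Suc j) y)
        \<le> (\<bar>s ^ j\<bar> * ((LINT z|lborel. norm (a z)) * (M (Suc (Suc j)) * s\<^sup>2))) * h\<^sup>2"
      by (simp only: norm_mult norm_of_real mult.assoc)
  qed
  show "nderiv j (\<lambda>y. LINT z|lborel. a z * b (s * y + t * z)) = ?G j"
    by (rule nderiv_sequence[where F="?G", OF _ *]) simp
  show "smooth (\<lambda>y. LINT z|lborel. a z * b (s * y + t * z))"
    by (rule smooth_sequence[where F="?G", OF _ *]) simp
qed

text \<open>Each cell of width \<open>d\<close> contributes at most \<open>B * d\<^sup>2\<close>, by
  comparison with the left endpoint, and the induction adds one cell. For fixed
  \<open>real n * d\<close> the total is of order \<open>d\<close>.\<close>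

lemma riemann_sum_bound:
  assumes g: "smooth g" and B: "\<And>x. norm (nderiv (Suc 0) g x) \<le> B" and d: "0 \<le> d"
  shows "norm (integral {a..a + real n * d} g - (\<Sum>i<n. of_real d * g (a + real i * d))) \<le> real n * (B * d\<^sup>2)"
proof (induction n)
  case (Suc n)
  define c where "c = a + real n * d"
  have cont: "continuous_on S g" for S using smooth_continuous_on[OF g, of S 0] by simp
  have ac: "a \<le> c" "a + real (Suc n) * d = c + d" using d by (auto simp: c_def algebra_simps)
  have split: "integral {a..c} g + integral {c..c + d} g = integral {a..c + d} g"
    using ac d by (intro Henstock_Kurzweil_Integration.integral_combine integrable_continuous_real cont) auto
  have "integral {c..c + d} (\<lambda>x. g x - g c) = integral {c..c + d} g - integral {c..c + d} (\<lambda>x. g c)"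
    by (intro Henstock_Kurzweil_Integration.integral_diff integrable_continuous_real cont continuous_on_const)
  then have eq: "integral {c..c + d} g - of_real d * g c = integral {c..c + d} (\<lambda>x. g x - g c)"
    using d by (simp add: scaleR_conv_of_real)
  have "norm (integral {c..c + d} (\<lambda>x. g x - g c)) \<le> (B * d) * (c + d - c)"
  proof (rule integral_bound)
    show "norm (g x - g c) \<le> B * d" if "x \<in> {c..c + d}" for x
    proof -
      have "0 \<le> B" using norm_ge_zero B by (rule order_trans)
      have "norm (g x - g c) \<le> B * \<bar>x - c\<bar>"
        using nderiv_diff_bound[OF g, of c x 0 B] B by simp
      also have "\<dots> \<le> B * d" using that \<open>0 \<le> B\<close> by (intro mult_left_mono) auto
      finally show ?thesis .
    qed
  qed (use d in \<open>auto intro: continuous_intros cont\<close>)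
  then have step: "norm (integral {c..c + d} g - of_real d * g c) \<le> B * d\<^sup>2"
    unfolding eq by (simp add: power2_eq_square mult.assoc)
  have "integral {a..a + real (Suc n) * d} g - (\<Sum>i<Suc n. of_real d * g (a + real i * d)) =
      (integral {a..c} g - (\<Sum>i<n. of_real d * g (a + real i * d))) + (integral {c..c + d} g - of_real d * g c)"
    unfolding ac(2) split[symmetric] by (simp add: c_def)
  also have "norm \<dots> \<le> real n * (B * d\<^sup>2) + B * d\<^sup>2"
    using Suc.IH step unfolding c_def[symmetric] by (intro norm_triangle_mono)
  finally show ?case by (simp add: algebra_simps)
qed simp

text \<open>\<open>L\<close> must not depend on \<open>\<psi>\<close>, which is later the mollifier at a scale tending to \<open>0\<close>.\<close>

lemma convolution_riemann_sums:
  assumes \<phi>: "\<phi> \<in> test_functions"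
  obtains L where "0 \<le> L" "\<And>\<psi> k e. \<psi> \<in> decaying \<Longrightarrow> 0 < e \<Longrightarrow>
    \<exists>(c :: nat \<Rightarrow> complex) x n. (\<Sum>i<n. norm (c i)) \<le> L \<and>
      DLp_norm k 1 (\<lambda>y. (LINT z|lborel. \<phi> z * \<psi> (- 1 * y + 1 * z)) - (\<Sum>i<n. c i * \<psi> (x i - y))) < e"
proof -
  have \<phi>d: "\<phi> \<in> decaying" by (rule test_function_decaying[OF \<phi>])
  have \<phi>s: "smooth \<phi>" by (rule test_function_smooth[OF \<phi>])
  obtain R where R: "0 < R" "\<And>j x. R < \<bar>x\<bar> \<Longrightarrow> nderiv j \<phi> x = 0"
    by (rule test_function_support[OF \<phi>]) (rule that)
  obtain M where M: "0 \<le> M" "\<And>x. norm (nderiv 0 \<phi> x) \<le> M"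
    by (rule decaying_bounded[OF \<phi>d]) (rule that)
  obtain A where A: "0 \<le> A" "\<And>j y. j \<le> 1 \<Longrightarrow> norm (nderiv j \<phi> y) \<le> A / (1 + y\<^sup>2)"
    by (rule decaying_bound[OF \<phi>d]) (rule that)
  show thesis
  proof (rule that)
    \<comment> \<open>The length of \<open>{- R..R}\<close> times a bound of
      \<open>norm (\<phi> x)\<close>; the coefficients will be
      \<open>d * \<phi> (x i)\<close>.\<close>
    show "0 \<le> 2 * R * M" using R M by simp
    fix \<psi> k and e :: real assume \<psi>: "\<psi> \<in> decaying" and e: "0 < e"
    have \<psi>s: "smooth \<psi>" by (rule decaying_smooth[OF \<psi>])
    have \<psi>b: "\<exists>M. \<forall>x. norm (nderiv j \<psi> x) \<le> M" for j
      using decaying_bounded[OF \<psi>, of j] by blast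
    have \<phi>i: "integrable lborel \<phi>"
      using decaying_DLp_1[OF \<phi>d] DLp_1_iff nderiv_0 by metis
    obtain B where B: "0 \<le> B" "\<And>j y. j \<le> Suc k \<Longrightarrow> norm (nderiv j \<psi> y) \<le> B / (1 + y\<^sup>2)"
      by (rule decaying_bound[OF \<psi>]) (rule that)
    let ?F = "\<lambda>y. LINT z|lborel. \<phi> z * \<psi> (- 1 * y + 1 * z)"
    let ?g = "\<lambda>j y x. \<phi> x * nderiv j \<psi> (x - y)"
    have g: "smooth (?g j y)" for j y
      using smooth_mult[OF \<phi>s smooth_affine[OF smooth_nderiv[OF \<psi>s, of j], of 1 "- y"]] by simp
    \<comment> \<open>Recentring the weight of \<open>\<psi>\<close> from \<open>x\<close> to 0
      costs \<open>1 + x\<^sup>2\<close>, which cancels against the decay of \<open>\<phi>\<close>.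
      The result is uniform in the integration variable \<open>x\<close> and still integrable in
      \<open>y\<close>.\<close>
    have prod: "norm (nderiv i \<phi> x * nderiv j \<psi> (x - y)) \<le> 2 * A * B / (1 + y\<^sup>2)"
      if "i \<le> 1" "j \<le> Suc k" for i j x y
    proof -
      have "norm (nderiv j \<psi> (x - y)) \<le> B / (1 + (y + (- x))\<^sup>2)"
        using B(2)[OF that(2), of "x - y"] by (simp add: power2_commute)
      also have "\<dots> \<le> 2 * (1 + x\<^sup>2) * B / (1 + y\<^sup>2)"
        using weight_shift[OF B(1), of y "- x"] by simp
      finally have "norm (nderiv i \<phi> x) * norm (nderiv j \<psi> (x - y))
          \<le> A / (1 + x\<^sup>2) * (2 * (1 + x\<^sup>2) * B / (1 + y\<^sup>2))"
        using A(1) by (intro mult_mono A(2) that) (auto intro!: divide_nonneg_nonneg add_nonneg_nonneg)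
      also have "\<dots> = 2 * A * B / (1 + y\<^sup>2)"
      proof -
        have "A / a * (2 * a * B / b) = 2 * A * B / b" if "0 < a" for a b :: real
          using that by simp
        from this[OF add_pos_nonneg[OF zero_less_one zero_le_power2]] show ?thesis .
      qed
      finally show ?thesis by (simp add: norm_mult)
    qed
    have g': "norm (nderiv (Suc 0) (?g j y) x) \<le> 4 * A * B / (1 + y\<^sup>2)" if "j \<le> k" for j y x
    proof -
      have "nderiv (Suc 0) (?g j y) x = nderiv 0 \<phi> x * nderiv (Suc j) \<psi> (x - y) + nderiv 1 \<phi> x * nderiv j \<psi> (x - y)"
        using nderiv_mult[OF \<phi>s smooth_affine[OF smooth_nderiv[OF \<psi>s, of j], of 1 "- y"], of "Suc 0"]
          nderiv_affine[OF smooth_nderiv[OF \<psi>s, of j], of "Suc 0" 1 "- y"]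
        by (simp add: nderiv_nderiv)
      also have "norm \<dots> \<le> 2 * A * B / (1 + y\<^sup>2) + 2 * A * B / (1 + y\<^sup>2)"
        using that by (intro norm_triangle_mono prod) auto
      finally show ?thesis by (simp add: field_simps)
    qed
    \<comment> \<open>As \<open>\<phi>\<close> vanishes outside \<open>{- R..R}\<close>, the
      Lebesgue integral becomes a gauge integral over this interval, the form treated by
      \<open>riemann_sum_bound\<close>.\<close>
    have int: "(LINT z|lborel. \<phi> z * nderiv j \<psi> (- 1 * y + 1 * z)) = integral {- R..R} (?g j y)" for j y
    proof -
      obtain M' where M': "\<And>x. norm (nderiv j \<psi> x) \<le> M'" using \<psi>b by blast
      have "integrable lborel (?g j y)"
        using smooth_measurable[OF smooth_affine[OF smooth_nderiv[OF \<psi>s, of j], of 1 "- y"], of 0] M'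
        by (intro integrable_mult_bounded[OF \<phi>i]) auto
      then have "(LINT z|lborel. \<phi> z * nderiv j \<psi> (- 1 * y + 1 * z)) = integral UNIV (?g j y)"
        using integral_lborel[of "?g j y"] by simp
      also have "\<dots> = integral UNIV (\<lambda>x. if x \<in> {- R..R} then ?g j y x else 0)"
        using R(2)[of _ 0] by (intro arg_cong[where f="integral UNIV"] ext) (auto simp: abs_if)
      also have "\<dots> = integral {- R..R} (?g j y)"
        by (rule Henstock_Kurzweil_Integration.integral_restrict_UNIV)
      finally show ?thesis .
    qed
    \<comment> \<open>The total error is \<open>Q / real n\<close>: each of the \<open>Suc k\<close>
      derivatives contributes the weight integral \<open>pi\<close> times \<open>4 * A * B\<close>,
      and \<open>real n * d\<^sup>2 = (2 * R)\<^sup>2 / real n\<close>.\<close>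
    define Q where "Q = real (Suc k) * (4 * A * B * (2 * R)\<^sup>2 * pi)"
    obtain n where n: "Q / e < real n" "0 < n"
      using reals_Archimedean2[of "max 0 (Q / e)"] by auto
    define d where "d = 2 * R / real n"
    have d: "0 \<le> d" "real n * d = 2 * R" using R n by (auto simp: d_def)
    define x where "x i = - R + real i * d" for i
    let ?S = "\<lambda>y. \<Sum>i<n. (of_real d * \<phi> (x i)) * \<psi> (x i - y)"
    have Fs: "smooth ?F" by (rule smooth_integral[OF \<phi>i \<psi>s \<psi>b])
    have Ss: "smooth ?S" by (intro smooth_sum smooth_cmult smooth_reflect \<psi>s) simp
    have "DLp_norm k 1 (\<lambda>y. ?F y - ?S y) \<le> real (Suc k) * ((4 * A * B * (real n * d\<^sup>2)) * pi)"
    proof (rule DLp_norm_1_weight_bound[where x=0])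
      show "smooth (\<lambda>y. ?F y - ?S y)" by (rule smooth_diff[OF Fs Ss])
      fix j y assume j: "j \<le> k"
      have "nderiv j ?S y = (\<Sum>i<n. nderiv j (\<lambda>y. (of_real d * \<phi> (x i)) * \<psi> (x i - y)) y)"
        by (subst nderiv_sum) (auto intro!: smooth_cmult smooth_reflect \<psi>s)
      also have "\<dots> = (- 1) ^ j * (\<Sum>i<n. of_real d * ?g j y (x i))"
        unfolding nderiv_cmult[OF smooth_reflect[OF \<psi>s]] nderiv_reflect[OF \<psi>s]
        by (simp add: sum_distrib_left mult_ac)
      finally have "nderiv j ?S y = \<dots>" .
      moreover have "nderiv j ?F y = (- 1) ^ j * integral {- R..R} (?g j y)"
        unfolding nderiv_integral[OF \<phi>i \<psi>s \<psi>b] int by simp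
      ultimately have "norm (nderiv j (\<lambda>y. ?F y - ?S y) y) =
          norm (integral {- R..R} (?g j y) - (\<Sum>i<n. of_real d * ?g j y (x i)))"
        unfolding nderiv_diff[OF Fs Ss]
        by (simp only: right_diff_distrib[symmetric] norm_mult norm_power norm_minus_cancel norm_one power_one mult_1)
      also have "\<dots> \<le> real n * (4 * A * B / (1 + y\<^sup>2) * d\<^sup>2)"
        using riemann_sum_bound[where a="- R" and n=n, OF g[of j y] g'[OF j, of y] d(1)] unfolding d(2) x_def by simp
      finally show "norm (nderiv j (\<lambda>y. ?F y - ?S y) y) \<le> 4 * A * B * (real n * d\<^sup>2) / (1 + (0 - y)\<^sup>2)"
        by (simp add: mult_ac)
    qed
    also have "\<dots> = Q / real n"
      using n by (simp add: Q_def d_def power2_eq_square field_simps)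
    also have "\<dots> < e" using n e by (simp add: field_simps)
    finally have "DLp_norm k 1 (\<lambda>y. ?F y - ?S y) < e" .
    moreover have "(\<Sum>i<n. norm (of_real d * \<phi> (x i))) \<le> 2 * R * M"
    proof -
      have "(\<Sum>i<n. norm (of_real d * \<phi> (x i))) \<le> (\<Sum>i<n. d * M)"
        using M d by (intro sum_mono) (auto simp: norm_mult intro!: mult_left_mono)
      also have "\<dots> = 2 * R * M" using d(2) by (simp flip: d(2))
      finally show ?thesis .
    qed
    ultimately show "\<exists>(c :: nat \<Rightarrow> complex) x n. (\<Sum>i<n. norm (c i)) \<le> 2 * R * M \<and>
        DLp_norm k 1 (\<lambda>y. ?F y - (\<Sum>i<n. c i * \<psi> (x i - y))) < e"
      by (intro exI[of _ "\<lambda>i. of_real d * \<phi> (x i)"] exI[of _ x] exI[of _ n]) simp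
  qed
qed

section \<open>Scaled mollifiers and the averages of a test function\<close>

lemma mollifier_decaying: "\<rho> \<in> mollifiers \<Longrightarrow> \<rho> \<in> decaying"
  by (simp add: mollifiers_def schwartz_decaying)

lemma mollify_scale_decaying:
  assumes "\<rho> \<in> decaying" "\<epsilon> \<noteq> 0" shows "mollify_scale \<rho> \<epsilon> \<in> decaying"
  using decaying_cmult[OF decaying_scale[OF assms(1), of "1 / \<epsilon>"], of "of_real (1 / \<epsilon>)"] assms(2)
  by (simp add: mollify_scale_def)

lemma nderiv_mollify_scale:
  assumes "smooth \<rho>"
  shows "nderiv j (mollify_scale \<rho> \<epsilon>) x = of_real ((1 / \<epsilon>) ^ Suc j) * nderiv j \<rho> (x / \<epsilon>)"
proof -
  have *: "mollify_scale \<rho> \<epsilon> = (\<lambda>x. of_real (1 / \<epsilon>) * \<rho> (1 / \<epsilon> * x + 0))"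
    by (simp add: mollify_scale_def)
  show ?thesis
    unfolding * nderiv_cmult[OF smooth_affine[OF assms]] nderiv_affine[OF assms] by simp
qed

text \<open>Since \<open>\<rho>\<close> has integral 1, the error is the average of
  \<open>nderiv j \<phi> (y + \<epsilon> * z) - nderiv j \<phi> y\<close> against
  \<open>\<rho>\<close>. The mean value inequality yields \<open>\<epsilon> * \<bar>z\<bar>\<close>,
  and \<open>schwartz_moment_bound\<close> absorbs the growth in \<open>z\<close>.\<close>

lemma mollify_approximation:
  assumes \<rho>: "\<rho> \<in> mollifiers" and \<phi>: "\<phi> \<in> decaying"
  obtains K where "0 \<le> K" "\<And>\<epsilon> j y. \<epsilon> \<in> {0<..1} \<Longrightarrow> j \<le> k \<Longrightarrow>
    norm (nderiv j (\<lambda>y. LINT z|lborel. \<rho> z * \<phi> (1 * y + \<epsilon> * z)) y - nderiv j \<phi> y) \<le> \<epsilon> * K / (1 + y\<^sup>2)"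
proof -
  have \<rho>S: "\<rho> \<in> schwartz_space" and \<rho>1: "(LINT z|lborel. \<rho> z) = 1" using \<rho> by (auto simp: mollifiers_def)
  have \<rho>i: "integrable lborel \<rho>"
    using decaying_DLp_1[OF mollifier_decaying[OF \<rho>]] DLp_1_iff nderiv_0 by metis
  have \<phi>s: "smooth \<phi>" by (rule decaying_smooth[OF \<phi>])
  have \<phi>b: "\<exists>M. \<forall>x. norm (nderiv j \<phi> x) \<le> M" for j
    using decaying_bounded[OF \<phi>, of j] by blast
  obtain D where D: "0 \<le> D" "\<And>z. norm (\<rho> z) * (\<bar>z\<bar> * (1 + z\<^sup>2)) \<le> D / (1 + z\<^sup>2)"
    by (rule schwartz_moment_bound[OF \<rho>S]) (rule that)
  obtain C where C: "0 \<le> C" "\<And>j y. j \<le> Suc k \<Longrightarrow> norm (nderiv j \<phi> y) \<le> C / (1 + y\<^sup>2)"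
    by (rule decaying_bound[OF \<phi>]) (rule that)
  show thesis
  proof (rule that)
    show "0 \<le> 2 * C * (D * pi)" using C D by simp
    fix \<epsilon> j y assume \<epsilon>: "\<epsilon> \<in> {0<..1::real}" and j: "j \<le> k"
    let ?d = "\<lambda>z. nderiv j \<phi> (1 * y + \<epsilon> * z) - nderiv j \<phi> y"
    let ?q = "\<epsilon> * (2 * C) / (1 + y\<^sup>2)"
    obtain M where M: "\<And>x. norm (nderiv j \<phi> x) \<le> M" using \<phi>b by blast
    have m: "(\<lambda>z. nderiv j \<phi> (1 * y + \<epsilon> * z)) \<in> borel_measurable lborel"
      by (rule smooth_affine_measurable[OF \<phi>s])
    have i: "integrable lborel (\<lambda>z. \<rho> z * nderiv j \<phi> (1 * y + \<epsilon> * z))"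
      by (rule integrable_mult_bounded[OF \<rho>i m M])
    have eq: "nderiv j (\<lambda>y. LINT z|lborel. \<rho> z * \<phi> (1 * y + \<epsilon> * z)) y - nderiv j \<phi> y = (LINT z|lborel. \<rho> z * ?d z)"
      unfolding nderiv_integral[OF \<rho>i \<phi>s \<phi>b] right_diff_distrib
      using i \<rho>i \<rho>1 by simp
    have d: "norm (?d z) \<le> ?q * (\<bar>z\<bar> * (1 + z\<^sup>2))" for z
    proof -
      have "norm (?d z) \<le> 2 * (1 + z\<^sup>2) * C / (1 + y\<^sup>2) * \<bar>1 * y + \<epsilon> * z - y\<bar>"
      proof (rule nderiv_diff_bound[OF \<phi>s])
        fix t assume t: "t \<in> closed_segment y (1 * y + \<epsilon> * z)"
        then have "\<bar>t - y\<bar> \<le> \<bar>\<epsilon> * z\<bar>"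
          by (auto simp: closed_segment_eq_real_ivl split: if_splits)
        \<comment> \<open>The restriction \<open>\<epsilon> \<le> 1\<close> makes the shift, and
          with it the constant, independent of \<open>\<epsilon>\<close>.\<close>
        also have "\<dots> \<le> \<bar>z\<bar>" using \<epsilon> by (simp add: abs_mult mult_left_le_one_le)
        finally have tz: "(t - y)\<^sup>2 \<le> z\<^sup>2" by (simp add: abs_le_square_iff)
        have "norm (nderiv (Suc j) \<phi> t) \<le> C / (1 + (y + (t - y))\<^sup>2)"
          using C(2)[of "Suc j" t] j by simp
        also have "\<dots> \<le> 2 * (1 + (t - y)\<^sup>2) * C / (1 + y\<^sup>2)"
          by (rule weight_shift[OF C(1)])
        also have "\<dots> \<le> 2 * (1 + z\<^sup>2) * C / (1 + y\<^sup>2)"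
          using tz C(1) by (intro divide_right_mono mult_right_mono mult_left_mono) auto
        finally show "norm (nderiv (Suc j) \<phi> t) \<le> 2 * (1 + z\<^sup>2) * C / (1 + y\<^sup>2)" .
      qed
      also have "\<dots> = ?q * (\<bar>z\<bar> * (1 + z\<^sup>2))"
        using \<epsilon> by (simp add: abs_mult)
      finally show ?thesis .
    qed
    have b: "norm (\<rho> z * ?d z) \<le> ?q * D / (1 + (0 - z)\<^sup>2)" for z
    proof -
      have "norm (\<rho> z * ?d z) \<le> norm (\<rho> z) * (?q * (\<bar>z\<bar> * (1 + z\<^sup>2)))"
        unfolding norm_mult by (intro mult_left_mono d) auto
      also have "\<dots> = ?q * (norm (\<rho> z) * (\<bar>z\<bar> * (1 + z\<^sup>2)))" by simp
      also have "\<dots> \<le> ?q * (D / (1 + z\<^sup>2))"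
        using \<epsilon> C(1) by (intro mult_left_mono D) (auto intro!: divide_nonneg_nonneg add_nonneg_nonneg)
      finally show ?thesis by simp
    qed
    have "norm (LINT z|lborel. \<rho> z * ?d z) \<le> (LINT z|lborel. norm (\<rho> z * ?d z))"
      by (rule integral_norm_bound)
    also have "\<dots> \<le> ?q * D * pi"
      by (intro integral_weight_bound[where x=0] b borel_measurable_times borel_measurable_diff m
          borel_measurable_const borel_measurable_integrable[OF \<rho>i])
    finally show "norm (nderiv j (\<lambda>y. LINT z|lborel. \<rho> z * \<phi> (1 * y + \<epsilon> * z)) y - nderiv j \<phi> y)
        \<le> \<epsilon> * (2 * C * (D * pi)) / (1 + y\<^sup>2)"
      unfolding eq by simp
  qed
qed

text \<open>The left form suits the approximation of \<open>\<phi>\<close>; the Riemann sums of the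
  right form are combinations of the functions
  \<open>mollify_scale \<rho> \<epsilon> (x - y)\<close> of \<open>y\<close>, on which a
  distribution takes the values of its convolution.\<close>

lemma mollify_substitution:
  assumes "\<epsilon> > 0"
  shows "(LINT z|lborel. \<rho> z * \<phi> (1 * y + \<epsilon> * z)) =
    (LINT z|lborel. \<phi> z * mollify_scale \<rho> \<epsilon> (- 1 * y + 1 * z))"
proof -
  have *: "- y / \<epsilon> + 1 / \<epsilon> * z = (z - y) / \<epsilon>" for z
    by (simp add: diff_divide_distrib)
  have "(LINT z|lborel. \<rho> z * \<phi> (1 * y + \<epsilon> * z)) =
      \<bar>1 / \<epsilon>\<bar> *\<^sub>R (LINT z|lborel. \<rho> ((z - y) / \<epsilon>) * \<phi> (1 * y + \<epsilon> * ((z - y) / \<epsilon>)))"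
    using assms lborel_integral_real_affine[of "1 / \<epsilon>" "\<lambda>z. \<rho> z * \<phi> (1 * y + \<epsilon> * z)" "- y / \<epsilon>"]
    unfolding * by simp
  also have "\<dots> = of_real (1 / \<epsilon>) * (LINT z|lborel. \<phi> z * \<rho> ((z - y) / \<epsilon>))"
    using assms by (simp add: scaleR_conv_of_real mult.commute)
  also have "\<dots> = (LINT z|lborel. of_real (1 / \<epsilon>) * (\<phi> z * \<rho> ((z - y) / \<epsilon>)))"
    by (rule integral_mult_right_zero[symmetric])
  finally show ?thesis by (simp add: mollify_scale_def mult_ac)
qed

text \<open>Two limits in a fixed order: for given \<open>\<epsilon>\<close> the Riemann error
  \<open>\<eta>\<close> tends to 0, then \<open>\<epsilon>\<close> tends to 0. As \<open>L\<close>
  is obtained before \<open>\<epsilon>\<close> is fixed, the constant \<open>Q\<close> survives the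
  second limit.\<close>

lemma dist_vanishes_on_test_functions:
  assumes w: "w \<in> bounded_distributions" and \<rho>: "\<rho> \<in> mollifiers"
    and K: "\<forall>\<^sub>F \<epsilon> in at_right 0. \<forall>x. norm (dist_conv w (mollify_scale \<rho> \<epsilon>) x) \<le> K * \<epsilon>"
    and \<phi>: "\<phi> \<in> test_functions"
  shows "w \<phi> = 0"
proof -
  obtain k C where C: "0 \<le> C" "\<And>\<phi>. \<phi> \<in> DLp 1 \<Longrightarrow> norm (w \<phi>) \<le> C * DLp_norm k 1 \<phi>"
    by (rule bounded_distribution_bound[OF w]) (rule that)
  have \<phi>d: "\<phi> \<in> decaying" by (rule test_function_decaying[OF \<phi>])
  have \<rho>d: "\<rho> \<in> decaying" by (rule mollifier_decaying[OF \<rho>])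
  have \<rho>i: "integrable lborel \<rho>"
    using decaying_DLp_1[OF \<rho>d] DLp_1_iff nderiv_0 by metis
  have \<phi>b: "\<exists>M. \<forall>x. norm (nderiv j \<phi> x) \<le> M" for j
    using decaying_bounded[OF \<phi>d, of j] by blast
  obtain L where L: "0 \<le> L" "\<And>\<psi> k e. \<psi> \<in> decaying \<Longrightarrow> 0 < e \<Longrightarrow>
    \<exists>(c :: nat \<Rightarrow> complex) x n. (\<Sum>i<n. norm (c i)) \<le> L \<and>
      DLp_norm k 1 (\<lambda>y. (LINT z|lborel. \<phi> z * \<psi> (- 1 * y + 1 * z)) - (\<Sum>i<n. c i * \<psi> (x i - y))) < e"
    by (rule convolution_riemann_sums[OF \<phi>]) (erule that, blast)
  obtain B where B: "0 \<le> B" "\<And>\<epsilon> j y. \<epsilon> \<in> {0<..1} \<Longrightarrow> j \<le> k \<Longrightarrow>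
    norm (nderiv j (\<lambda>y. LINT z|lborel. \<rho> z * \<phi> (1 * y + \<epsilon> * z)) y - nderiv j \<phi> y) \<le> \<epsilon> * B / (1 + y\<^sup>2)"
    by (rule mollify_approximation[OF \<rho> \<phi>d, where k=k]) (erule that, blast)
  \<comment> \<open>The first summand measures the distance from \<open>\<phi>\<close> to its
    average, the second the value of \<open>w\<close> on that average.\<close>
  define Q where "Q = C * (real (Suc k) * (B * pi)) + L * K"
  have main: "norm (w \<phi>) \<le> Q * \<epsilon>"
    if \<epsilon>: "\<epsilon> \<in> {0<..1}" and K: "\<forall>x. norm (dist_conv w (mollify_scale \<rho> \<epsilon>) x) \<le> K * \<epsilon>" for \<epsilon>
  proof -
    let ?\<Phi> = "\<lambda>y. LINT z|lborel. \<rho> z * \<phi> (1 * y + \<epsilon> * z)"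
    let ?\<psi> = "mollify_scale \<rho> \<epsilon>"
    have \<psi>: "?\<psi> \<in> decaying" using \<epsilon> by (intro mollify_scale_decaying \<rho>d) auto
    have \<phi>s: "smooth \<phi>" by (rule test_function_smooth[OF \<phi>])
    have \<Phi>s: "smooth ?\<Phi>" by (rule smooth_integral[OF \<rho>i \<phi>s \<phi>b])
    let ?\<delta> = "\<lambda>y. ?\<Phi> y - \<phi> y"
    have \<delta>s: "smooth ?\<delta>" by (rule smooth_diff[OF \<Phi>s \<phi>s])
    have "?\<delta> \<in> decaying"
      unfolding decaying_def
    proof (intro CollectI conjI \<delta>s allI)
      fix j
      \<comment> \<open>\<open>decaying\<close> concerns every order \<open>j\<close>, whereas the
        outer \<open>B\<close> serves the orders up to \<open>k\<close>.\<close>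
      obtain B where "\<And>\<epsilon> i y. \<epsilon> \<in> {0<..1} \<Longrightarrow> i \<le> j \<Longrightarrow>
          norm (nderiv i (\<lambda>y. LINT z|lborel. \<rho> z * \<phi> (1 * y + \<epsilon> * z)) y - nderiv i \<phi> y) \<le> \<epsilon> * B / (1 + y\<^sup>2)"
        by (rule mollify_approximation[OF \<rho> \<phi>d, where k=j]) (rule that, blast)
      from this[OF \<epsilon> order.refl] show "\<exists>C. \<forall>y. norm (nderiv j ?\<delta> y) \<le> C / (1 + y\<^sup>2)"
        unfolding nderiv_diff[OF \<Phi>s \<phi>s] by (intro exI allI)
    qed
    then have D: "?\<delta> \<in> DLp 1" "\<phi> \<in> DLp 1"
      by (auto intro: decaying_DLp_1 \<phi>d)
    have \<Phi>D: "?\<Phi> \<in> DLp 1" using DLp_1_add[OF D] by simp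
    have "norm (w ?\<delta>) \<le> C * DLp_norm k 1 ?\<delta>" by (rule C(2)[OF D(1)])
    also have "\<dots> \<le> C * (real (Suc k) * ((\<epsilon> * B) * pi))"
    proof (intro mult_left_mono DLp_norm_1_weight_bound[where x=0] \<delta>s C(1))
      show "norm (nderiv j ?\<delta> y) \<le> \<epsilon> * B / (1 + (0 - y)\<^sup>2)" if "j \<le> k" for j y
        using B(2)[OF \<epsilon> that, of y] unfolding nderiv_diff[OF \<Phi>s \<phi>s] by simp
    qed
    finally have 1: "norm (w ?\<Phi> - w \<phi>) \<le> C * (real (Suc k) * ((\<epsilon> * B) * pi))"
      by (simp only: dist_minus[OF w \<Phi>D D(2)])
    have "norm (w ?\<Phi>) \<le> L * K * \<epsilon> + \<eta>" if \<eta>: "0 < \<eta>" for \<eta>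
    proof -
      obtain c x and n :: nat where c: "(\<Sum>i<n. norm (c i)) \<le> L"
        "DLp_norm k 1 (\<lambda>y. (LINT z|lborel. \<phi> z * ?\<psi> (- 1 * y + 1 * z)) - (\<Sum>i<n. c i * ?\<psi> (x i - y))) < \<eta> / (C + 1)"
        using L(2)[OF \<psi>, of "\<eta> / (C + 1)" k] \<eta> C(1) by auto
      let ?S = "\<lambda>y. \<Sum>i<n. c i * ?\<psi> (x i - y)"
      have r: "(\<lambda>y. ?\<psi> (x i - y)) \<in> DLp 1" for i
        by (intro DLp_1_reflect decaying_DLp_1 \<psi>)
      have S: "?S \<in> DLp 1" by (intro DLp_1_sum DLp_1_cmult r) simp
      have c': "DLp_norm k 1 (\<lambda>y. ?\<Phi> y - ?S y) < \<eta> / (C + 1)"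
        using c(2) mollify_substitution[of \<epsilon> \<rho> \<phi>] \<epsilon> by simp
      have "norm (w ?\<Phi> - w ?S) \<le> C * DLp_norm k 1 (\<lambda>y. ?\<Phi> y - ?S y)"
        using C(2)[OF DLp_1_diff[OF \<Phi>D S]] by (simp only: dist_minus[OF w \<Phi>D S])
      also have "\<dots> \<le> (C + 1) * DLp_norm k 1 (\<lambda>y. ?\<Phi> y - ?S y)"
        by (intro mult_right_mono DLp_norm_1_nonneg) simp
      also have "\<dots> \<le> \<eta>" using c' C(1) by (simp add: field_simps)
      finally have "norm (w ?\<Phi> - w ?S) \<le> \<eta>" .
      moreover have "w ?S = (\<Sum>i<n. c i * dist_conv w ?\<psi> (x i))"
        by (subst dist_sum[OF w]) (auto intro: DLp_1_cmult r simp: dist_cmult[OF w r] dist_conv_def)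
      then have "norm (w ?S) \<le> (\<Sum>i<n. norm (c i) * (K * \<epsilon>))"
        using K by (auto simp: norm_mult intro!: sum_norm_le mult_left_mono)
      \<comment> \<open>The sign \<open>0 \<le> K * \<epsilon>\<close> is read off from the
        hypothesis, where this number dominates a norm.\<close>
      moreover have "\<dots> \<le> L * (K * \<epsilon>)"
        using c(1) order_trans[OF norm_ge_zero K[rule_format]]
        by (simp add: sum_distrib_right[symmetric] mult_right_mono)
      ultimately show ?thesis
        using norm_triangle_sub[of "w ?\<Phi>" "w ?S"] by simp
    qed
    then have "norm (w ?\<Phi>) \<le> L * K * \<epsilon>" by (rule field_le_epsilon)
    then show ?thesis
      using 1 norm_triangle_sub[of "w \<phi>" "w ?\<Phi>"]
      by (simp add: Q_def norm_minus_commute algebra_simps)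
  qed
  have "\<forall>\<^sub>F \<epsilon> in at_right 0. norm (w \<phi>) \<le> Q * \<epsilon>"
    using K eventually_at_right_0_Ioc by eventually_elim (rule main)
  moreover have "((\<lambda>\<epsilon>. Q * \<epsilon>) \<longlongrightarrow> Q * 0) (at_right 0)"
    by (intro tendsto_intros)
  ultimately have "norm (w \<phi>) \<le> Q * 0"
    by (intro tendsto_le[OF _ _ tendsto_const]) auto
  then show ?thesis by simp
qed

lemma dist_eq_zero_if_test_functions:
  assumes w: "w \<in> bounded_distributions" and 0: "\<And>\<phi>. \<phi> \<in> test_functions \<Longrightarrow> w \<phi> = 0"
    and \<phi>: "\<phi> \<in> DLp 1"
  shows "w \<phi> = 0"
proof -
  obtain k C where C: "0 \<le> C" "\<And>\<phi>. \<phi> \<in> DLp 1 \<Longrightarrow> norm (w \<phi>) \<le> C * DLp_norm k 1 \<phi>"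
    by (rule bounded_distribution_bound[OF w]) (rule that)
  have "norm (w \<phi>) \<le> 0 + e" if e: "0 < e" for e
  proof -
    obtain \<psi> where \<psi>: "\<psi> \<in> test_functions" "DLp_norm k 1 (\<lambda>x. \<psi> x - \<phi> x) < e / (C + 1)"
      using test_functions_dense[OF \<phi>, of "e / (C + 1)" k] e C(1) by auto
    have \<psi>D: "\<psi> \<in> DLp 1" by (intro decaying_DLp_1 test_function_decaying \<psi>)
    have "norm (w \<phi>) = norm (w (\<lambda>x. \<psi> x - \<phi> x))"
      by (simp add: dist_minus[OF w \<psi>D \<phi>] 0 \<psi>)
    also have "\<dots> \<le> C * DLp_norm k 1 (\<lambda>x. \<psi> x - \<phi> x)"
      by (intro C DLp_1_diff \<psi>D \<phi>)
    also have "\<dots> \<le> (C + 1) * DLp_norm k 1 (\<lambda>x. \<psi> x - \<phi> x)"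
      by (intro mult_right_mono DLp_norm_1_nonneg) simp
    also have "\<dots> \<le> e" using \<psi>(2) C(1) by (simp add: field_simps)
    finally show ?thesis by simp
  qed
  then have "norm (w \<phi>) \<le> 0" by (rule field_le_epsilon)
  then show ?thesis by simp
qed

section \<open>The embedding\<close>

lemma DLp_norm_1_mono: "k \<le> k' \<Longrightarrow> DLp_norm k 1 \<phi> \<le> DLp_norm k' 1 \<phi>"
  unfolding DLp_norm_1 by (intro sum_mono2) auto

lemma ap_distribution_bounded: "u \<in> ap_distributions \<Longrightarrow> u \<in> bounded_distributions"
  by (simp add: ap_distributions_def)

lemma dist_conv_B_ap:
  assumes u: "u \<in> ap_distributions" and \<psi>: "\<psi> \<in> decaying"
  shows "dist_conv u \<psi> \<in> B_ap"
  using u ap_distribution_conv_C_ap[of u, OF _ _ decaying_nderiv[OF \<psi>]]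
  by (simp add: B_ap_iff ap_distributions_def nderiv_dist_conv smooth_dist_conv \<psi>)

text \<open>For \<open>\<epsilon> \<le> 1\<close> the dilation moves points outwards, where the
  weight is smaller, so the only growth is the prefactor \<open>(1 / \<epsilon>) ^ Suc j\<close>.
  The condition \<open>j < m\<close> lets one exponent serve all orders.\<close>

lemma mollify_scale_weight_bound:
  assumes "smooth \<rho>" "\<And>y. norm (nderiv j \<rho> y) \<le> B / (1 + y\<^sup>2)" "0 \<le> B" "\<epsilon> \<in> {0<..1}" "j < m"
  shows "norm (nderiv j (mollify_scale \<rho> \<epsilon>) y) \<le> (1 / \<epsilon>) ^ m * B / (1 + y\<^sup>2)"
proof -
  have \<epsilon>: "1 \<le> 1 / \<epsilon>" using assms(4) by simp
  have "\<bar>y\<bar> * 1 \<le> \<bar>y\<bar> * (1 / \<epsilon>)" by (intro mult_left_mono \<epsilon>) simp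
  then have "y\<^sup>2 \<le> (y / \<epsilon>)\<^sup>2" using assms(4) by (simp add: abs_le_square_iff[symmetric])
  then have "B / (1 + (y / \<epsilon>)\<^sup>2) \<le> B / (1 + y\<^sup>2)"
    using assms(3) by (intro divide_left_mono mult_pos_pos add_pos_nonneg) auto
  then have "norm (nderiv j \<rho> (y / \<epsilon>)) \<le> B / (1 + y\<^sup>2)"
    using assms(2)[of "y / \<epsilon>"] by simp
  moreover have "(1 / \<epsilon>) ^ Suc j \<le> (1 / \<epsilon>) ^ m"
    using \<epsilon> assms(5) by (intro power_increasing) auto
  ultimately have "(1 / \<epsilon>) ^ Suc j * norm (nderiv j \<rho> (y / \<epsilon>)) \<le> (1 / \<epsilon>) ^ m * (B / (1 + y\<^sup>2))"
    using assms(4) by (intro mult_mono) auto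
  moreover have "\<bar>1 / \<epsilon>\<bar> = 1 / \<epsilon>" using assms(4) by simp
  ultimately show ?thesis
    unfolding nderiv_mollify_scale[OF assms(1)] norm_mult norm_of_real power_abs by simp
qed

lemma mollify_net_M_ap:
  assumes \<rho>: "\<rho> \<in> decaying" and u: "u \<in> ap_distributions"
  shows "mollify_net \<rho> u \<in> M_ap"
proof -
  have ub: "u \<in> bounded_distributions" by (rule ap_distribution_bounded[OF u])
  have \<rho>s: "smooth \<rho>" by (rule decaying_smooth[OF \<rho>])
  have \<rho>\<epsilon>: "mollify_scale \<rho> \<epsilon> \<in> decaying" if "\<epsilon> \<in> {0<..1}" for \<epsilon>
    using that by (intro mollify_scale_decaying \<rho>) auto
  have B_ap: "dist_conv u (mollify_scale \<rho> \<epsilon>) \<in> B_ap" if "\<epsilon> \<in> {0<..1}" for \<epsilon>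
    by (rule dist_conv_B_ap[OF u \<rho>\<epsilon>[OF that]])
  have "\<exists>m::nat. (\<lambda>\<epsilon>. DLp_norm l \<infinity> (mollify_net \<rho> u \<epsilon>)) \<in> O[at_right 0](\<lambda>\<epsilon>. \<epsilon> powr (- real m))" for l
  proof -
    obtain k C where C: "0 \<le> C" "\<And>\<phi>. \<phi> \<in> DLp 1 \<Longrightarrow> norm (u \<phi>) \<le> C * DLp_norm k 1 \<phi>"
      by (rule bounded_distribution_bound[OF ub]) (rule that)
    obtain B where B: "0 \<le> B" "\<And>j y. j \<le> k + l \<Longrightarrow> norm (nderiv j \<rho> y) \<le> B / (1 + y\<^sup>2)"
      by (rule decaying_bound[OF \<rho>]) (rule that)
    \<comment> \<open>\<open>k\<close> derivatives from the continuity estimate of \<open>u\<close>,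
      \<open>l\<close> from the norm, and one power from the normalising factor of
      \<open>mollify_scale\<close>.\<close>
    define m where "m = Suc (k + l)"
    define Q where "Q = real (Suc l) * (C * (real (Suc k) * (B * pi)))"
    have bound: "DLp_norm l \<infinity> (mollify_net \<rho> u \<epsilon>) \<le> Q * (1 / \<epsilon>) ^ m" if \<epsilon>: "\<epsilon> \<in> {0<..1}" for \<epsilon>
    proof -
      let ?\<psi> = "mollify_scale \<rho> \<epsilon>"
      have "Lp_norm \<infinity> (nderiv j (dist_conv u ?\<psi>)) \<le> C * (real (Suc k) * (((1 / \<epsilon>) ^ m * B) * pi))"
        if j: "j \<le> l" for j
      proof (rule B_ap_Lp_norm_le[OF B_ap[OF \<epsilon>]])
        fix x
        have D: "nderiv j ?\<psi> \<in> DLp 1" by (intro decaying_DLp_1 decaying_nderiv \<rho>\<epsilon> \<epsilon>)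
        have "norm (nderiv j (dist_conv u ?\<psi>) x) = norm (u (\<lambda>y. nderiv j ?\<psi> (x - y)))"
          unfolding nderiv_dist_conv[OF ub \<rho>\<epsilon>[OF \<epsilon>]] by (simp add: dist_conv_def)
        also have "\<dots> \<le> C * DLp_norm k 1 (\<lambda>y. nderiv j ?\<psi> (x - y))"
          by (intro C(2) DLp_1_reflect D)
        also have "\<dots> = C * DLp_norm k 1 (nderiv j ?\<psi>)"
          by (simp only: DLp_norm_1_reflect[OF DLp_1_smooth[OF D]])
        also have "\<dots> \<le> C * (real (Suc k) * (((1 / \<epsilon>) ^ m * B) * pi))"
        proof (intro mult_left_mono[OF _ C(1)] DLp_norm_1_weight_bound[where x=0] DLp_1_smooth D)
          fix i y assume "i \<le> k"
          then show "norm (nderiv i (nderiv j ?\<psi>) y) \<le> (1 / \<epsilon>) ^ m * B / (1 + (0 - y)\<^sup>2)"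
            using mollify_scale_weight_bound[OF \<rho>s B(2) B(1) \<epsilon>, of "i + j" m y] j
            by (simp add: nderiv_nderiv m_def)
        qed
        finally show "norm (nderiv j (dist_conv u ?\<psi>) x) \<le> C * (real (Suc k) * (((1 / \<epsilon>) ^ m * B) * pi))" .
      qed
      then have "DLp_norm l \<infinity> (dist_conv u ?\<psi>) \<le> (\<Sum>j\<le>l. C * (real (Suc k) * (((1 / \<epsilon>) ^ m * B) * pi)))"
        unfolding DLp_norm_def by (intro sum_mono) auto
      also have "\<dots> = Q * (1 / \<epsilon>) ^ m" unfolding Q_def by (simp only: sum_constant card_atMost mult_ac)
      finally show ?thesis using \<epsilon> by (simp add: mollify_net_def)
    qed
    have "(\<lambda>\<epsilon>. DLp_norm l \<infinity> (mollify_net \<rho> u \<epsilon>)) \<in> O[at_right 0](\<lambda>\<epsilon>. \<epsilon> powr (- real m))"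
    proof (rule bigoI[where c=Q])
      show "\<forall>\<^sub>F \<epsilon> in at_right 0. norm (DLp_norm l \<infinity> (mollify_net \<rho> u \<epsilon>)) \<le> Q * norm (\<epsilon> powr (- real m))"
        using eventually_at_right_0_Ioc
      proof eventually_elim
        case (elim \<epsilon>)
        have "\<epsilon> powr (- real m) = (1 / \<epsilon>) ^ m"
          using elim by (simp add: powr_minus powr_realpow power_one_over inverse_eq_divide)
        moreover have "0 \<le> DLp_norm l \<infinity> (mollify_net \<rho> u \<epsilon>)"
          using elim B_ap[OF elim] by (simp add: mollify_net_def B_ap_DLp_norm_nonneg)
        ultimately show ?case using bound[OF elim] elim by simp
      qed
    qed
    then show ?thesis ..
  qed
  then show ?thesis
    using B_ap by (auto simp: M_ap_def mollify_net_def)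
qed

section \<open>Linear operations and differentiation on distributions\<close>

lemma dist_add_bounded:
  assumes u: "u \<in> bounded_distributions" and v: "v \<in> bounded_distributions"
  shows "dist_add u v \<in> bounded_distributions"
proof -
  obtain k C where C: "0 \<le> C" "\<And>\<phi>. \<phi> \<in> DLp 1 \<Longrightarrow> norm (u \<phi>) \<le> C * DLp_norm k 1 \<phi>"
    by (rule bounded_distribution_bound[OF u]) (rule that)
  obtain l D where D: "0 \<le> D" "\<And>\<phi>. \<phi> \<in> DLp 1 \<Longrightarrow> norm (v \<phi>) \<le> D * DLp_norm l 1 \<phi>"
    by (rule bounded_distribution_bound[OF v]) (rule that)
  show ?thesis
  proof (rule bounded_distributionI[where k="k + l" and C="C + D"])
    fix \<phi> assume \<phi>: "\<phi> \<in> DLp 1"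
    have "C * DLp_norm k 1 \<phi> \<le> C * DLp_norm (k + l) 1 \<phi>" "D * DLp_norm l 1 \<phi> \<le> D * DLp_norm (k + l) 1 \<phi>"
      by (intro mult_left_mono DLp_norm_1_mono C(1) D(1) le_add1 le_add2)+
    then show "norm (dist_add u v \<phi>) \<le> (C + D) * DLp_norm (k + l) 1 \<phi>"
      using norm_triangle_ineq[of "u \<phi>" "v \<phi>"] C(2)[OF \<phi>] D(2)[OF \<phi>] \<phi>
      by (simp add: dist_add_def algebra_simps)
  qed (auto simp: dist_add_def DLp_1_add DLp_1_cmult dist_plus[OF u] dist_plus[OF v]
      dist_cmult[OF u] dist_cmult[OF v] algebra_simps)
qed

lemma dist_scale_bounded:
  assumes u: "u \<in> bounded_distributions"
  shows "dist_scale c u \<in> bounded_distributions"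
proof -
  obtain k C where C: "0 \<le> C" "\<And>\<phi>. \<phi> \<in> DLp 1 \<Longrightarrow> norm (u \<phi>) \<le> C * DLp_norm k 1 \<phi>"
    by (rule bounded_distribution_bound[OF u]) (rule that)
  show ?thesis
  proof (rule bounded_distributionI[where k=k and C="norm c * C"])
    fix \<phi> assume \<phi>: "\<phi> \<in> DLp 1"
    then show "norm (dist_scale c u \<phi>) \<le> norm c * C * DLp_norm k 1 \<phi>"
      using mult_left_mono[OF C(2)[OF \<phi>], of "norm c"] by (simp add: dist_scale_def norm_mult mult.assoc)
  qed (auto simp: dist_scale_def DLp_1_add DLp_1_cmult dist_plus[OF u] dist_cmult[OF u] algebra_simps)
qed

lemma dist_deriv_bounded:
  assumes u: "u \<in> bounded_distributions"
  shows "dist_deriv j u \<in> bounded_distributions"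
proof -
  obtain k C where C: "0 \<le> C" "\<And>\<phi>. \<phi> \<in> DLp 1 \<Longrightarrow> norm (u \<phi>) \<le> C * DLp_norm k 1 \<phi>"
    by (rule bounded_distribution_bound[OF u]) (rule that)
  show ?thesis
  proof (rule bounded_distributionI[where k="k + j" and C=C])
    fix \<phi> assume \<phi>: "\<phi> \<in> DLp 1"
    have "norm (u (nderiv j \<phi>)) \<le> C * DLp_norm k 1 (nderiv j \<phi>)"
      by (intro C(2) DLp_1_nderiv \<phi>)
    also have "\<dots> \<le> C * DLp_norm (k + j) 1 \<phi>"
      by (intro mult_left_mono DLp_norm_1_nderiv C(1))
    finally show "norm (dist_deriv j u \<phi>) \<le> C * DLp_norm (k + j) 1 \<phi>"
      using \<phi> by (simp add: dist_deriv_def norm_mult norm_power)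
  qed (auto simp: dist_deriv_def DLp_1_add DLp_1_cmult nderiv_add nderiv_cmult DLp_1_smooth
      DLp_1_nderiv dist_plus[OF u] dist_cmult[OF u] algebra_simps)
qed

lemma dist_conv_add:
  "\<psi> \<in> DLp 1 \<Longrightarrow> dist_conv (dist_add u v) \<psi> = (\<lambda>x. dist_conv u \<psi> x + dist_conv v \<psi> x)"
  by (simp add: dist_conv_def dist_add_def DLp_1_reflect)

lemma dist_conv_scale:
  "\<psi> \<in> DLp 1 \<Longrightarrow> dist_conv (dist_scale c u) \<psi> = (\<lambda>x. c * dist_conv u \<psi> x)"
  by (simp add: dist_conv_def dist_scale_def DLp_1_reflect)

text \<open>The sign \<open>(- 1) ^ j\<close> of the distributional derivative cancels the one
  produced by the reflection \<open>x - y\<close>.\<close>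

lemma dist_conv_deriv:
  assumes u: "u \<in> bounded_distributions" and \<psi>: "\<psi> \<in> DLp 1"
  shows "dist_conv (dist_deriv j u) \<psi> = dist_conv u (nderiv j \<psi>)"
proof
  fix x
  have "dist_conv (dist_deriv j u) \<psi> x = (- 1) ^ j * u (\<lambda>y. (- 1) ^ j * nderiv j \<psi> (x - y))"
    by (simp add: dist_conv_def dist_deriv_def DLp_1_reflect \<psi> nderiv_reflect[OF DLp_1_smooth[OF \<psi>]])
  also have "\<dots> = (- 1) ^ j * ((- 1) ^ j * u (\<lambda>y. nderiv j \<psi> (x - y)))"
    by (simp only: dist_cmult[OF u DLp_1_reflect[OF DLp_1_nderiv[OF \<psi>]]])
  also have "\<dots> = dist_conv u (nderiv j \<psi>) x"
    by (simp add: dist_conv_def flip: mult.assoc power_mult_distrib)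
  finally show "dist_conv (dist_deriv j u) \<psi> x = dist_conv u (nderiv j \<psi>) x" .
qed

lemma test_function_DLp_1: "\<phi> \<in> test_functions \<Longrightarrow> \<phi> \<in> DLp 1"
  by (intro decaying_DLp_1 test_function_decaying)

lemma ap_distributions_add:
  "u \<in> ap_distributions \<Longrightarrow> v \<in> ap_distributions \<Longrightarrow> dist_add u v \<in> ap_distributions"
  by (simp add: ap_distributions_def dist_add_bounded dist_conv_add test_function_DLp_1 C_ap_add)

lemma ap_distributions_scale: "u \<in> ap_distributions \<Longrightarrow> dist_scale c u \<in> ap_distributions"
  by (simp add: ap_distributions_def dist_scale_bounded dist_conv_scale test_function_DLp_1 C_ap_cmult)

lemma ap_distributions_deriv: "u \<in> ap_distributions \<Longrightarrow> dist_deriv j u \<in> ap_distributions"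
  by (simp add: ap_distributions_def dist_deriv_bounded dist_conv_deriv test_function_DLp_1
      test_function_nderiv)

text \<open>The operations already agree on these representatives, so for cosets only independence
  of representatives remains.\<close>

lemma
  assumes \<rho>: "\<rho> \<in> decaying"
  shows mollify_net_add: "mollify_net \<rho> (dist_add u v) = net_add (mollify_net \<rho> u) (mollify_net \<rho> v)"
    and mollify_net_scale: "mollify_net \<rho> (dist_scale c u) = net_scale c (mollify_net \<rho> u)"
    and mollify_net_deriv: "u \<in> bounded_distributions \<Longrightarrow>
      mollify_net \<rho> (dist_deriv j u) = net_deriv j (mollify_net \<rho> u)"
proof -
  have d: "mollify_scale \<rho> \<epsilon> \<in> decaying" if "\<epsilon> \<in> {0<..1}" for \<epsilon>
    using that by (intro mollify_scale_decaying \<rho>) auto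
  show "mollify_net \<rho> (dist_add u v) = net_add (mollify_net \<rho> u) (mollify_net \<rho> v)"
    unfolding mollify_net_def net_add_def
    by (rule restrict_ext) (simp add: dist_conv_add decaying_DLp_1 d)
  show "mollify_net \<rho> (dist_scale c u) = net_scale c (mollify_net \<rho> u)"
    unfolding mollify_net_def net_scale_def
    by (rule restrict_ext) (simp add: dist_conv_scale decaying_DLp_1 d)
  show "mollify_net \<rho> (dist_deriv j u) = net_deriv j (mollify_net \<rho> u)" if "u \<in> bounded_distributions"
    unfolding mollify_net_def net_deriv_def
    by (rule restrict_ext) (simp add: dist_conv_deriv nderiv_dist_conv that decaying_DLp_1 d)
qed

text \<open>Equality of cosets provides a negligible net \<open>n\<close> that coincides with the
  mollified difference \<open>w\<close> for every \<open>\<epsilon>\<close>; its smallness is the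
  estimate that \<open>dist_vanishes_on_test_functions\<close> asks for.\<close>

lemma inj_on_i_ap:
  assumes \<rho>: "\<rho> \<in> mollifiers"
  shows "inj_on (i_ap \<rho>) ap_distributions"
proof (rule inj_onI)
  fix u v assume u: "u \<in> ap_distributions" and v: "v \<in> ap_distributions"
    and eq: "i_ap \<rho> u = i_ap \<rho> v"
  have \<rho>d: "\<rho> \<in> decaying" by (rule mollifier_decaying[OF \<rho>])
  have ub: "u \<in> bounded_distributions" and vb: "v \<in> bounded_distributions"
    using u v by (auto intro: ap_distribution_bounded)
  have "mollify_net \<rho> u \<in> net_class (mollify_net \<rho> v)"
    using net_class_self[of "mollify_net \<rho> u"] eq u v by (simp add: i_ap_def mollify_net_def)
  then obtain n where n: "n \<in> N_ap" "mollify_net \<rho> u = net_add (mollify_net \<rho> v) n"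
    by (auto simp: net_class_def)
  define w where "w = dist_add u (dist_scale (- 1) v)"
  have w: "w \<in> bounded_distributions"
    unfolding w_def by (intro dist_add_bounded dist_scale_bounded ub vb)
  have conv: "dist_conv w (mollify_scale \<rho> \<epsilon>) x = n \<epsilon> x" if \<epsilon>: "\<epsilon> \<in> {0<..1}" for \<epsilon> x
  proof -
    have "mollify_scale \<rho> \<epsilon> \<in> DLp 1"
      using \<epsilon> by (intro decaying_DLp_1 mollify_scale_decaying \<rho>d) auto
    moreover have "dist_conv u (mollify_scale \<rho> \<epsilon>) x = dist_conv v (mollify_scale \<rho> \<epsilon>) x + n \<epsilon> x"
      using fun_cong[OF fun_cong[OF n(2), of \<epsilon>], of x] \<epsilon> by (simp add: mollify_net_def net_add_def)
    ultimately show ?thesis by (simp add: w_def dist_conv_add dist_conv_scale)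
  qed
  \<comment> \<open>Order 0 and rate 1: the norm of order 0 is the supremum norm, so the bound is
    uniform in \<open>x\<close>.\<close>
  obtain K where "\<forall>\<^sub>F \<epsilon> in at_right 0. norm (DLp_norm 0 \<infinity> (n \<epsilon>)) \<le> K * norm (\<epsilon> ^ 1)"
    using N_ap_bigo[OF n(1), of 0 1] by (elim landau_o.bigE)
  then have "\<forall>\<^sub>F \<epsilon> in at_right 0. \<forall>x. norm (dist_conv w (mollify_scale \<rho> \<epsilon>) x) \<le> K * \<epsilon>"
    using eventually_at_right_0_Ioc
  proof eventually_elim
    case (elim \<epsilon>)
    have "norm (n \<epsilon> x) \<le> K * \<epsilon>" for x
      using B_ap_norm_bound[OF N_ap_B_ap[OF n(1) elim(2)], of 0 x] elim by (simp add: DLp_norm_def)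
    then show ?case using conv[OF elim(2)] by simp
  qed
  then have w0: "w \<phi> = 0" if "\<phi> \<in> DLp 1" for \<phi>
    by (intro dist_eq_zero_if_test_functions[OF w _ that] dist_vanishes_on_test_functions[OF w \<rho>])
  show "u = v"
  proof (rule extensionalityI[OF dist_extensional[OF ub] dist_extensional[OF vb]])
    show "u \<phi> = v \<phi>" if "\<phi> \<in> DLp 1" for \<phi>
      using w0[OF that] that by (simp add: w_def dist_add_def dist_scale_def)
  qed
qed

text \<open>\<open>i_ap \<rho>\<close> is \<open>undefined\<close> outside
  \<open>ap_distributions\<close>, so each identity is accompanied by the closure of
  \<open>ap_distributions\<close> under the operation concerned.\<close>

theorem proposition3:
  fixes \<rho> :: "real \<Rightarrow> complex"
  assumes "\<rho> \<in> mollifiers"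
  shows "(\<forall>u\<in>ap_distributions. mollify_net \<rho> u \<in> M_ap) \<and>
    i_ap \<rho> \<in> ap_distributions \<rightarrow> G_ap \<and>
    (\<forall>u\<in>ap_distributions. \<forall>v\<in>ap_distributions.
       dist_add u v \<in> ap_distributions \<and>
       i_ap \<rho> (dist_add u v) = G_add (i_ap \<rho> u) (i_ap \<rho> v)) \<and>
    (\<forall>c. \<forall>u\<in>ap_distributions.
       dist_scale c u \<in> ap_distributions \<and>
       i_ap \<rho> (dist_scale c u) = G_scale c (i_ap \<rho> u)) \<and>
    inj_on (i_ap \<rho>) ap_distributions \<and>
    (\<forall>u\<in>ap_distributions. \<forall>j.
       dist_deriv j u \<in> ap_distributions \<and>
       i_ap \<rho> (dist_deriv j u) = G_deriv j (i_ap \<rho> u))"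
proof -
  have \<rho>: "\<rho> \<in> decaying" by (rule mollifier_decaying[OF assms])
  have M: "mollify_net \<rho> u \<in> M_ap" if "u \<in> ap_distributions" for u
    by (rule mollify_net_M_ap[OF \<rho> that])
  have deriv: "G_deriv j (net_class (mollify_net \<rho> u)) = net_class (mollify_net \<rho> (dist_deriv j u))"
    if "u \<in> ap_distributions" for u j
  proof -
    have "mollify_net \<rho> u \<epsilon> \<in> B_ap" if "\<epsilon> \<in> {0<..1}" for \<epsilon>
      using M[OF \<open>u \<in> ap_distributions\<close>] that by (auto simp: M_ap_def)
    from G_deriv_net_class[OF this] show ?thesis
      by (simp only: mollify_net_deriv[OF \<rho> ap_distribution_bounded[OF that]])
  qed
  show ?thesis
    using M inj_on_i_ap[OF assms]
    by (auto simp: i_ap_def G_ap_def ap_distributions_add ap_distributions_scale ap_distributions_deriv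
        mollify_net_add[OF \<rho>] mollify_net_scale[OF \<rho>] G_add_net_class G_scale_net_class deriv)
qed

end
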